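(* Let $\mathcal{X}$ be a complex Banach space and $\mathcal{T}:\mathbb{R}\to B(\mathcal{X})$ a strongly continuous representation by invertible isometries, with generator $iA$ (i.e. $iAx=\lim_{t\to 0}t^{-1}(\mathcal{T}(t)x-x)$ on its natural domain), and equip $\mathcal{X}$ with the $L^1(\mathbb{R})$-module structure $fx=\int_{\mathbb{R}} f(t)\mathcal{T}(-t)x\,dt$. Assume the Beurling spectrum $\Lambda(\mathcal{X})$ is compact and nonempty. Then $A\in B(\mathcal{X})$, $\sigma(A)=\Lambda(\mathcal{X})$, and the function $t\mapsto \mathcal{T}(t)=e^{itA}$ extends to an entire $B(\mathcal{X})$-valued function $\mathcal{T}(z)=e^{izA}=\mathcal{T}(t)e^{-\alpha A}=e^{-\alpha A}\mathcal{T}(t)$, $z=t+i\alpha$, satisfying \[\|\mathcal{T}(t+i\alpha)\|=\|\mathcal{T}(i\alpha)\|\le \max_{\lambda\in\Lambda(\mathcal{X})}e^{-\alpha\lambda},\qquad t,\alpha\in\mathbb{R}.\]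
   Context: Fourier transform on $L^1(\mathbb{R})$: $\hat f(\lambda)=\int f(t)e^{-it\lambda}\,dt$. The Beurling spectrum $\Lambda(N)$ of a set $N\subseteq\mathcal{X}$ is the set of $\gamma\in\mathbb{R}$ such that $\hat f(\gamma)=0$ for every $f\in L^1(\mathbb{R})$ with $fx=0$ for all $x\in N$. $\sigma(A)$ is the usual spectrum of the operator $A$. *)

theory Defs
  imports "HOL-Analysis.Analysis"
begin

text \<open>A complex Banach space is modelled as a real Banach space together with
  a bounded real-linear map J (multiplication by the imaginary unit i) such that
  J (J x) = - x and the complex scalar multiplication (a + i b) x = a x + b J x
  satisfies norm (c x) = cmod c * norm x.\<close>

definition cmult :: "('a::real_normed_vector \<Rightarrow>\<^sub>L 'a) \<Rightarrow> complex \<Rightarrow> 'a \<Rightarrow> 'a" where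
  "cmult J c x = Re c *\<^sub>R x + Im c *\<^sub>R J x"

definition complex_structure :: "('a::real_normed_vector \<Rightarrow>\<^sub>L 'a) \<Rightarrow> bool" where
  "complex_structure J \<longleftrightarrow> (\<forall>x. J (J x) = - x) \<and> (\<forall>c x. norm (cmult J c x) = cmod c * norm x)"

definition clin :: "('a::real_normed_vector \<Rightarrow>\<^sub>L 'a) \<Rightarrow> ('a \<Rightarrow>\<^sub>L 'a) \<Rightarrow> bool" where
  "clin J B \<longleftrightarrow> B o\<^sub>L J = J o\<^sub>L B"

definition cscale :: "('a::real_normed_vector \<Rightarrow>\<^sub>L 'a) \<Rightarrow> complex \<Rightarrow> ('a \<Rightarrow>\<^sub>L 'a) \<Rightarrow> ('a \<Rightarrow>\<^sub>L 'a)" where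
  "cscale J c B = Re c *\<^sub>R B + Im c *\<^sub>R (J o\<^sub>L B)"

definition cspectrum :: "('a::real_normed_vector \<Rightarrow>\<^sub>L 'a) \<Rightarrow> ('a \<Rightarrow>\<^sub>L 'a) \<Rightarrow> complex set" where
  "cspectrum J A = {mu. \<not> (\<exists>B. clin J B \<and>
       B o\<^sub>L (A - cscale J mu id_blinfun) = id_blinfun \<and>
       (A - cscale J mu id_blinfun) o\<^sub>L B = id_blinfun)}"

definition opow :: "('a::real_normed_vector \<Rightarrow>\<^sub>L 'a) \<Rightarrow> nat \<Rightarrow> ('a \<Rightarrow>\<^sub>L 'a)" where
  "opow B n = ((\<lambda>C. B o\<^sub>L C) ^^ n) id_blinfun"

definition opexp :: "('a::banach \<Rightarrow>\<^sub>L 'a) \<Rightarrow> ('a \<Rightarrow>\<^sub>L 'a)" where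
  "opexp B = (\<Sum>n. (1 / fact n) *\<^sub>R opow B n)"

definition fourier :: "(real \<Rightarrow> complex) \<Rightarrow> real \<Rightarrow> complex" where
  "fourier f \<gamma> = integral UNIV (\<lambda>t. f t * exp (- \<i> * of_real (t * \<gamma>)))"

definition l1act :: "('a::real_normed_vector \<Rightarrow>\<^sub>L 'a) \<Rightarrow> (real \<Rightarrow> ('a \<Rightarrow>\<^sub>L 'a)) \<Rightarrow> (real \<Rightarrow> complex) \<Rightarrow> 'a \<Rightarrow> 'a" where
  "l1act J T f x = integral UNIV (\<lambda>t. cmult J (f t) (T (- t) x))"

definition beurling_spectrum :: "('a::real_normed_vector \<Rightarrow>\<^sub>L 'a) \<Rightarrow> (real \<Rightarrow> ('a \<Rightarrow>\<^sub>L 'a)) \<Rightarrow> 'a set \<Rightarrow> real set" where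
  "beurling_spectrum J T N = {\<gamma>. \<forall>f. f absolutely_integrable_on UNIV \<longrightarrow>
      (\<forall>x\<in>N. l1act J T f x = 0) \<longrightarrow> fourier f \<gamma> = 0}"

end

theory Submission
  imports Defs "HOL-Probability.Sinc_Integral"
begin

text \<open>
  If \<open>s\<close> is outside the Beurling spectrum \<open>\<Lambda>\<close>, then \<open>A - s\<close> is bounded below, uniformly for \<open>s\<close> in a compact set.
  Hence the means \<open>P\<^sub>N(s) = \<integral> (1 - |t|/N) exp (\<i>st) T (-t) dt\<close> over \<open>[-N, N]\<close> tend to \<open>0\<close> uniformly there. By Fubini,
  \<open>\<integral> g(s) P\<^sub>N(s) x ds\<close> tends to \<open>f x\<close>, where \<open>f\<close> is the Fourier transform of \<open>g\<close>. So \<open>f x\<close> depends only on the values of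
  \<open>g\<close> near \<open>\<Lambda>\<close>, and multiplying \<open>g(s)\<close> by \<open>s\<close> amounts to applying \<open>A\<close>. If \<open>\<Lambda>\<close> is contained in the open interval from \<open>a\<close> to
  \<open>b\<close>, the triangle with apex at \<open>a\<close> and half-width \<open>b - a\<close> equals \<open>(b - s) / (b - a)\<close> near \<open>\<Lambda>\<close> and is the transform of a
  positive Fejer kernel, whence \<open>\<parallel>(b - A) x\<parallel> \<le> (b - a) \<parallel>x\<parallel>\<close>. This bounds \<open>A\<close>, and writing
  \<open>exp (-\<alpha>A) = exp (-\<alpha>b) exp (\<alpha>(b - A))\<close> it also gives the sharp norm estimate. Conversely, at a point where \<open>A - \<gamma>\<close> is
  invertible, a narrow Fejer kernel annihilates the space although its Fourier transform does not vanish at \<open>\<gamma>\<close>.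
\<close>

text \<open>The means tend to 0 because the generator carries an orbit integral over any interval to
  a difference of two vectors of the norm of \<open>x\<close>. The lower bound for
  \<open>A - s\<close> therefore bounds all orbit integrals, whatever their length, and the slope of
  the Fejer weight supplies a factor \<open>1 / N\<close>. The lower bound may degenerate towards
  \<Lambda>, so two functions \<open>g\<close> are compared only when they agree on an open
  neighbourhood of \<Lambda>. Hence the open interval, and hence a sharp estimate that is reached
  only as the interval shrinks. Until \<open>A\<close> is known to be bounded, every identity is
  stated for vectors of its domain; the bound obtained there extends to the whole space because the
  generator is closed and densely defined. The integrals of the module action take values in an
  arbitrary Banach space: their existence is proved by approximation, and dominated convergence is
  applied to scalar majorants.\<close>

section \<open>Integrability of an integrable scalar function times a bounded continuous orbit\<close>

text \<open>Riemann sums of \<open>F\<close> differ from those of \<open>h\<close> by at most the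
  Riemann sums of \<open>u\<close>, so both Cauchy criteria, first on a box and then for growing
  boxes, pass from \<open>h\<close> to \<open>F\<close> with an error controlled by the integral of
  \<open>u\<close>.\<close>

lemma integrable_on_UNIV_approx:
  fixes F :: "real \<Rightarrow> 'b::banach"
  assumes approx: "\<And>e. e > 0 \<Longrightarrow> \<exists>h u. h integrable_on UNIV \<and> (u::real \<Rightarrow> real) integrable_on UNIV \<and>
            (\<forall>t. norm (F t - h t) \<le> u t) \<and> integral UNIV u < e"
  shows "F integrable_on UNIV"
proof -
  have sub: "h integrable_on cbox a b" if "h integrable_on UNIV" for h :: "real \<Rightarrow> 'z::banach" and a b
    using that integrable_on_subcbox by blast
  have sub_le: "integral (cbox a b) u \<le> integral UNIV u"
    if "u integrable_on UNIV" "\<And>t. 0 \<le> u t" for u :: "real \<Rightarrow> real" and a b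
    using that sub[OF that(1), of a b] by (intro integral_subset_le) auto
  have int_cbox: "F integrable_on cbox a b" for a b
    unfolding integrable_Cauchy
  proof (intro allI impI)
    fix e :: real assume "e > 0"
    \<comment> \<open>Budget: the sum of \<open>u\<close> costs its integral plus one gauge error,
      the sum of \<open>h\<close> another gauge error. Three times \<open>e / 6\<close> puts each
      division within \<open>e / 2\<close> of the integral of \<open>h\<close>.\<close>
    then obtain h u where h: "h integrable_on UNIV" and u: "u integrable_on UNIV"
      and le: "\<And>t. norm (F t - h t) \<le> u t" and small: "integral UNIV u < e / 6"
      using approx[of "e/6"] by auto
    have u0: "0 \<le> u t" for t using le order_trans[OF norm_ge_zero] by blast
    have "integral (cbox a b) u < e / 6"
      using sub_le[OF u u0] small by (meson order_le_less_trans)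
    obtain d1 where d1: "gauge d1" "\<And>D. D tagged_division_of cbox a b \<Longrightarrow> d1 fine D \<Longrightarrow>
        norm ((\<Sum>(x,K)\<in>D. measure lborel K *\<^sub>R h x) - integral (cbox a b) h) < e / 6"
      using sub[OF h, of a b] \<open>e > 0\<close> unfolding has_integral_integral has_integral
      by (metis divide_pos_pos zero_less_numeral)
    obtain d2 where d2: "gauge d2" "\<And>D. D tagged_division_of cbox a b \<Longrightarrow> d2 fine D \<Longrightarrow>
        norm ((\<Sum>(x,K)\<in>D. measure lborel K *\<^sub>R u x) - integral (cbox a b) u) < e / 6"
      using sub[OF u, of a b] \<open>e > 0\<close> unfolding has_integral_integral has_integral
      by (metis divide_pos_pos zero_less_numeral)
    have close: "norm ((\<Sum>(x,K)\<in>D. measure lborel K *\<^sub>R F x) - integral (cbox a b) h) < e / 2"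
      if D: "D tagged_division_of cbox a b" "d1 fine D" "d2 fine D" for D
    proof -
      have "norm ((\<Sum>(x,K)\<in>D. measure lborel K *\<^sub>R F x) - (\<Sum>(x,K)\<in>D. measure lborel K *\<^sub>R h x))
          = norm (\<Sum>(x,K)\<in>D. measure lborel K *\<^sub>R (F x - h x))"
        by (simp add: sum_subtractf[symmetric] split_def scaleR_diff_right)
      also have "\<dots> \<le> (\<Sum>(x,K)\<in>D. measure lborel K *\<^sub>R u x)"
        by (intro sum_norm_le) (auto simp: split_def le mult_left_mono)
      also have "\<dots> < e / 6 + e / 6"
        using d2(2)[OF D(1,3)] \<open>integral (cbox a b) u < e / 6\<close> unfolding real_norm_def by linarith
      finally have "norm ((\<Sum>(x,K)\<in>D. measure lborel K *\<^sub>R F x) - (\<Sum>(x,K)\<in>D. measure lborel K *\<^sub>R h x)) < e / 6 + e / 6" .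
      from norm_diff_triangle_less[OF this d1(2)[OF D(1,2)]] show ?thesis by simp
    qed
    show "\<exists>\<gamma>. gauge \<gamma> \<and> (\<forall>\<D>1 \<D>2. \<D>1 tagged_division_of cbox a b \<and> \<gamma> fine \<D>1 \<and>
            \<D>2 tagged_division_of cbox a b \<and> \<gamma> fine \<D>2 \<longrightarrow>
            norm ((\<Sum>(x, K)\<in>\<D>1. measure lborel K *\<^sub>R F x) - (\<Sum>(x, K)\<in>\<D>2. measure lborel K *\<^sub>R F x)) < e)"
    proof (intro exI conjI allI impI)
      show "gauge (\<lambda>x. d1 x \<inter> d2 x)" using d1(1) d2(1) by (rule gauge_Int)
      fix D1 D2
      assume "D1 tagged_division_of cbox a b \<and> (\<lambda>x. d1 x \<inter> d2 x) fine D1 \<and>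
            D2 tagged_division_of cbox a b \<and> (\<lambda>x. d1 x \<inter> d2 x) fine D2"
      then have "norm ((\<Sum>(x,K)\<in>D1. measure lborel K *\<^sub>R F x) - integral (cbox a b) h) < e / 2"
        "norm ((\<Sum>(x,K)\<in>D2. measure lborel K *\<^sub>R F x) - integral (cbox a b) h) < e / 2"
        using close by (auto simp: fine_Int)
      then show "norm ((\<Sum>(x, K)\<in>D1. measure lborel K *\<^sub>R F x) - (\<Sum>(x, K)\<in>D2. measure lborel K *\<^sub>R F x)) < e"
        using norm_diff_triangle_less[where y = "integral (cbox a b) h"]
        by (metis norm_minus_commute field_sum_of_halves)
    qed
  qed
  have "\<exists>B>0. \<forall>a b c d. ball 0 B \<subseteq> cbox a b \<and> ball 0 B \<subseteq> cbox c d \<longrightarrow>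
      norm (integral (cbox a b) F - integral (cbox c d) F) < e" if "e > 0" for e
  proof -
    obtain h u where h: "h integrable_on UNIV" and u: "u integrable_on UNIV"
      and le: "\<And>t. norm (F t - h t) \<le> u t" and small: "integral UNIV u < e / 3"
      using approx[of "e/3"] \<open>e > 0\<close> by auto
    have u0: "0 \<le> u t" for t using le order_trans[OF norm_ge_zero] by blast
    have near: "norm (integral (cbox a b) F - integral (cbox a b) h) < e / 3" for a b
    proof -
      have "norm (integral (cbox a b) (\<lambda>t. F t - h t)) \<le> integral (cbox a b) u"
        by (intro integral_norm_bound_integral integrable_diff int_cbox sub h u le)
      also have "\<dots> < e / 3" using sub_le[OF u u0] small by (meson order_le_less_trans)
      finally show ?thesis using integral_diff[OF int_cbox sub[OF h]] by metis
    qed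
    obtain B where "B > 0" and B: "\<And>a b c d. ball 0 B \<subseteq> cbox a b \<Longrightarrow> ball 0 B \<subseteq> cbox c d \<Longrightarrow>
      norm (integral (cbox a b) h - integral (cbox c d) h) < e / 3"
    proof -
      have "\<forall>e>0. \<exists>B>0. \<forall>a b c d. ball 0 B \<subseteq> cbox a b \<and> ball 0 B \<subseteq> cbox c d \<longrightarrow>
          norm (integral (cbox a b) h - integral (cbox c d) h) < e"
        using h[unfolded integrable_alt[of h]] by simp
      from this[rule_format, of "e / 3"] \<open>e > 0\<close> that show thesis by auto
    qed
    show ?thesis
    proof (intro exI[of _ B] conjI allI impI)
      fix a b c d :: real assume "ball 0 B \<subseteq> cbox a b \<and> ball 0 B \<subseteq> cbox c d"
      then have "norm (integral (cbox a b) h - integral (cbox c d) h) < e / 3"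
        using B by blast
      moreover have "norm (x + y - z) \<le> norm x + norm y + norm z" for x y z :: 'b
        by (meson norm_triangle_ineq norm_triangle_ineq4 add_right_mono order_trans)
      from this[of "integral (cbox a b) F - integral (cbox a b) h"
          "integral (cbox a b) h - integral (cbox c d) h" "integral (cbox c d) F - integral (cbox c d) h"]
      have "norm (integral (cbox a b) F - integral (cbox c d) F) \<le>
          norm (integral (cbox a b) F - integral (cbox a b) h) +
          norm (integral (cbox a b) h - integral (cbox c d) h) +
          norm (integral (cbox c d) F - integral (cbox c d) h)" by simp
      ultimately show "norm (integral (cbox a b) F - integral (cbox c d) F) < e"
        using near[of a b] near[of c d] by linarith
    qed (rule \<open>B > 0\<close>)
  qed
  then show ?thesis
    unfolding integrable_alt[of F] using int_cbox by simp
qed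

text \<open>\<open>G\<close> is replaced by a step function on a bounded interval and by 0 outside.
  On one cell the integrand is then a bounded linear image of \<open>f\<close> on a measurable set.
  The error is small inside by uniform continuity of \<open>G\<close>, and outside because the tail
  of \<open>norm (f t)\<close> has small integral. The general \<open>p\<close> covers ordinary
  products as well as complex scalars acting through \<open>J\<close>.\<close>

lemma integrable_bilinear_continuous:
  fixes p :: "'u::euclidean_space \<Rightarrow> 'v::real_normed_vector \<Rightarrow> 'w::banach"
  assumes p: "bounded_bilinear p" and f: "f absolutely_integrable_on (UNIV :: real set)"
    and G: "continuous_on UNIV G" and bdd: "\<And>t. norm (G t) \<le> M"
  shows "(\<lambda>t. p (f t) (G t)) integrable_on UNIV"
proof (rule integrable_on_UNIV_approx)
  interpret p: bounded_bilinear p by fact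
  obtain C where C: "C > 0" "\<And>x y. norm (p x y) \<le> norm x * norm y * C"
    using p.pos_bounded by blast
  have M0: "0 \<le> M" using bdd norm_ge_zero order_trans by blast
  define n where "n t = norm (f t)" for t
  have nint: "n integrable_on UNIV"
    using f unfolding n_def absolutely_integrable_on_def by blast
  have n0: "n t \<ge> 0" for t by (simp add: n_def)
  fix e :: real assume "e > 0"
  define I where "I = integral UNIV n"
  have I0: "I \<ge> 0" unfolding I_def using nint n0 by (simp add: integral_nonneg)
  have nsub: "n integrable_on {a..b}" for a b
    using nint integrable_on_subcbox[of n UNIV a b] by auto
  have "(\<lambda>k. integral UNIV (\<lambda>t. if t \<in> {- real k..<real k} then n t else 0)) \<longlonglongrightarrow> integral UNIV n"
  proof (rule dominated_convergence(2))
    show "(\<lambda>t. if t \<in> {- real k..<real k} then n t else 0) integrable_on UNIV" for k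
      unfolding integrable_restrict_UNIV using nsub
      by (rule integrable_spike_set[of _ "{-real k..real k}"])
         (auto intro: negligible_subset[of "{real k}"])
    show "(\<lambda>k. if t \<in> {- real k..<real k} then n t else 0) \<longlonglongrightarrow> n t" for t
    proof (rule tendsto_eventually)
      show "\<forall>\<^sub>F k in sequentially. (if t \<in> {- real k..<real k} then n t else 0) = n t"
        using eventually_gt_at_top[of "nat \<lceil>\<bar>t\<bar>\<rceil>"] by eventually_elim (auto, linarith+)
    qed
  qed (use nint n0 in auto)
  then obtain k where k: "integral UNIV n - integral UNIV (\<lambda>t. if t \<in> {- real k..<real k} then n t else 0) < e / (2 * C * (M + 1))"
  proof -
    assume lim: "(\<lambda>k. integral UNIV (\<lambda>t. if t \<in> {- real k..<real k} then n t else 0)) \<longlonglongrightarrow> integral UNIV n"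
      and *: "\<And>k. integral UNIV n - integral UNIV (\<lambda>t. if t \<in> {- real k..<real k} then n t else 0) < e / (2 * C * (M + 1)) \<Longrightarrow> thesis"
    have "0 < e / (2 * C * (M + 1))" using \<open>e > 0\<close> C M0 by simp
    from LIMSEQ_D[OF lim this] show thesis using * by (force simp: abs_less_iff)
  qed
  define nk where "nk t = (if t \<in> {- real k..<real k} then n t else 0)" for t
  have nkint: "nk integrable_on UNIV"
    unfolding nk_def integrable_restrict_UNIV using nsub
    by (rule integrable_spike_set[of _ "{-real k..real k}"])
       (auto intro: negligible_subset[of "{real k}"])
  \<comment> \<open>Half of \<open>e\<close> is spent inside and half on the tail; the added 1 keeps
    the denominators positive when \<open>I\<close> or \<open>M\<close> is 0.\<close>
  define d where "d = e / (2 * C * (I + 1))"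
  have d0: "d > 0" using \<open>e > 0\<close> C I0 by (simp add: d_def)
  have "uniformly_continuous_on {- real k..real k} G"
    using G by (intro compact_uniformly_continuous) (auto intro: continuous_on_subset)
  then obtain r where r: "r > 0" "\<And>s t. s \<in> {- real k..real k} \<Longrightarrow> t \<in> {- real k..real k} \<Longrightarrow> dist s t < r \<Longrightarrow> dist (G s) (G t) < d"
    using d0 unfolding uniformly_continuous_on_def by metis
  obtain m :: nat where m: "m > 0" "1 / real m < r"
    using reals_Archimedean[OF r(1)] by (metis inverse_eq_divide of_nat_0_less_iff zero_less_Suc)
  define g where "g j = real_of_int j / real m" for j
  \<comment> \<open>The half-open cells numbered by \<open>Jn\<close> tile exactly the half-open
    interval that truncates \<open>n\<close>, so \<open>h\<close> vanishes outside it.\<close>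
  define Jn where "Jn = {- (int k * int m)..<int k * int m}"
  define S where "S j = {t. \<lfloor>t * real m\<rfloor> = j}" for j
  have Smeas: "S j \<in> sets lebesgue" for j
  proof -
    have "{t \<in> space borel. \<lfloor>t * real m\<rfloor> = j} \<in> sets borel" by measurable
    then show ?thesis by (simp add: S_def)
  qed
  define h where "h t = (\<Sum>j\<in>Jn. if t \<in> S j then p (f t) (G (g j)) else 0)" for t
  have "h integrable_on UNIV"
  proof -
    have "(\<lambda>t. if t \<in> S j then p (f t) (G (g j)) else 0) integrable_on UNIV" for j
    proof -
      have "f absolutely_integrable_on S j"
        using f Smeas set_integrable_subset by blast
      then have "f integrable_on S j" by (rule set_lebesgue_integral_eq_integral)
      from integrable_linear[OF this p.bounded_linear_left[of "G (g j)"]]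
      show ?thesis unfolding integrable_restrict_UNIV by (simp add: o_def)
    qed
    then show ?thesis unfolding h_def by (intro integrable_sum) (auto simp: Jn_def)
  qed
  \<comment> \<open>The first summand pays for the oscillation of \<open>G\<close> inside; the
    second is nonzero only outside, where \<open>nk\<close> is 0.\<close>
  define u where "u t = C * (d * n t + M * (n t - nk t))" for t
  have "u integrable_on UNIV"
    unfolding u_def by (intro integrable_on_mult_right integrable_add integrable_diff nint nkint)
  moreover have "integral UNIV u = C * (d * I + M * (I - integral UNIV nk))"
    unfolding u_def I_def
    by (simp add: integral_add integral_diff nint nkint integrable_on_mult_right integrable_diff)
  moreover have "C * (d * I + M * (I - integral UNIV nk)) < e"
  proof -
    have "C * d * I < e / 2"
    proof -
      have "C * d = e / (2 * (I + 1))" using C(1) I0 by (simp add: d_def)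
      then have "C * d * I = (e / 2) * (I / (I + 1))" by simp
      also have "\<dots> < e / 2 * 1" using \<open>e > 0\<close> I0 by (intro mult_strict_left_mono) auto
      finally show ?thesis by simp
    qed
    moreover have "C * M * (I - integral UNIV nk) \<le> e / 2"
    proof -
      have "C * M * (I - integral UNIV nk) \<le> C * M * (e / (2 * C * (M + 1)))"
        using k C M0 unfolding I_def nk_def[abs_def] by (intro mult_left_mono) auto
      also have "\<dots> = (e / 2) * (M / (M + 1))" using C(1) by simp
      also have "\<dots> \<le> e / 2 * 1" using \<open>e > 0\<close> M0 by (intro mult_left_mono) auto
      finally show ?thesis by simp
    qed
    ultimately show ?thesis by (simp add: algebra_simps)
  qed
  moreover have "norm (p (f t) (G t) - h t) \<le> u t" for t
  proof (cases "t \<in> {- real k..<real k}")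
    case True
    define j where "j = \<lfloor>t * real m\<rfloor>"
    have fl: "real_of_int j \<le> t * real m" "t * real m < real_of_int j + 1"
      unfolding j_def by linarith+
    have "- (real k * real m) \<le> t * real m" "t * real m < real k * real m"
      using True m(1) mult_right_mono[of "- real k" t "real m"] mult_strict_right_mono[of t "real k" "real m"] by auto
    then have jJ: "j \<in> Jn"
      unfolding Jn_def j_def by (auto simp: le_floor_iff floor_less_iff)
    have "h t = (\<Sum>i\<in>Jn. if i = j then p (f t) (G (g i)) else 0)"
      unfolding h_def S_def j_def by (rule sum.cong) auto
    then have ht: "h t = p (f t) (G (g j))"
      using jJ by (simp add: Jn_def)
    have gj: "g j \<le> t" "t < g j + 1 / real m"
      using fl m(1) by (auto simp: g_def field_simps)
    moreover have "- real k \<le> g j"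
    proof -
      have "real_of_int (- (int k * int m)) \<le> real_of_int j"
        using jJ unfolding Jn_def of_int_le_iff by simp
      then have "- (real k * real m) \<le> real_of_int j" by simp
      then show ?thesis using m(1) by (simp add: g_def field_simps)
    qed
    ultimately have "norm (G t - G (g j)) \<le> d"
      using r(2)[of t "g j"] True m(2) by (auto simp: dist_norm)
    then have "n t * norm (G t - G (g j)) * C \<le> n t * d * C"
      using C(1) n0 by (intro mult_right_mono mult_left_mono) auto
    then have "norm (p (f t) (G t - G (g j))) \<le> n t * d * C"
      using C(2)[of "f t" "G t - G (g j)"] unfolding n_def by linarith
    then show ?thesis using True by (simp add: ht u_def nk_def p.diff_right mult_ac)
  next
    case False
    have "t \<notin> S j" if "j \<in> Jn" for j
    proof
      assume "t \<in> S j"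
      then have fl: "real_of_int j \<le> t * real m" "t * real m < real_of_int j + 1"
        unfolding S_def mem_Collect_eq by linarith+
      have "real_of_int (- (int k * int m)) \<le> real_of_int j" "real_of_int (j + 1) \<le> real_of_int (int k * int m)"
        using that unfolding Jn_def of_int_le_iff by auto
      then have "- (real k * real m) \<le> t * real m" "t * real m < real k * real m"
        using fl by auto
      then have "(- real k) * real m \<le> t * real m" "t * real m < real k * real m" by auto
      then have "- real k \<le> t" "t < real k"
        using m(1) mult_right_le_imp_le[of "- real k" "real m" t] mult_right_less_imp_less[of t "real m" "real k"] by auto
      then show False using False by simp
    qed
    then have "h t = 0" unfolding h_def by (simp add: sum.neutral)
    moreover have "norm (p (f t) (G t)) \<le> n t * M * C"
    proof -
      have "n t * norm (G t) * C \<le> n t * M * C"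
        using C(1) n0 bdd by (intro mult_right_mono mult_left_mono) auto
      then show ?thesis using C(2)[of "f t" "G t"] unfolding n_def by linarith
    qed
    moreover have "0 \<le> C * (d * n t)" using C d0 n0 by simp
    moreover have "nk t = 0" using False by (auto simp: nk_def)
    ultimately show ?thesis by (simp add: u_def algebra_simps)
  qed
  ultimately show "\<exists>h u. h integrable_on UNIV \<and> (u::real \<Rightarrow> real) integrable_on UNIV \<and>
            (\<forall>t. norm (p (f t) (G t) - h t) \<le> u t) \<and> integral UNIV u < e"
    using \<open>h integrable_on UNIV\<close> by (intro exI[of _ h] exI[of _ u]) auto
qed

section \<open>Groups of isometries and their generators\<close>

context
  fixes J :: "'a::real_normed_vector \<Rightarrow>\<^sub>L 'a"
  assumes cs: "complex_structure J"
begin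

lemma J_J [simp]: "J (J x) = - x"
  using cs by (simp add: complex_structure_def)

lemma norm_cmult: "norm (cmult J c x) = cmod c * norm x"
  using cs by (simp add: complex_structure_def)

lemma norm_J: "norm (J x) = norm x"
  using norm_cmult[of \<i> x] by (simp add: cmult_def)

lemma cmult_cmult: "cmult J a (cmult J b x) = cmult J (a * b) x"
  by (simp add: cmult_def blinfun.bilinear_simps algebra_simps)

lemma bounded_bilinear_cmult: "bounded_bilinear (cmult J)"
proof
  show "\<exists>K. \<forall>c x. norm (cmult J c x) \<le> norm c * norm x * K"
    by (rule exI[of _ 1]) (simp add: norm_cmult)
qed (simp_all add: cmult_def blinfun.bilinear_simps algebra_simps)

end

lemma cmult_of_real: "cmult J (of_real r) x = r *\<^sub>R x"
  by (simp add: cmult_def)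

lemma cmult_1 [simp]: "cmult J 1 x = x"
  by (simp add: cmult_def)

lemma cscale_apply: "cscale J c B x = cmult J c (B x)"
  by (simp add: cscale_def cmult_def blinfun.bilinear_simps)

text \<open>The group of \<open>exp (\<i>st) T (-t)\<close>, generated by \<open>\<i>(s - A)\<close> when \<open>T\<close> is generated by \<open>\<i>A\<close>. Twisting
  is an involution, so statements about \<open>A - s\<close> are statements about the generator of \<open>twist J s T\<close>.\<close>

definition twist :: "('a::real_normed_vector \<Rightarrow>\<^sub>L 'a) \<Rightarrow> real \<Rightarrow> (real \<Rightarrow> 'a \<Rightarrow>\<^sub>L 'a) \<Rightarrow> real \<Rightarrow> 'a \<Rightarrow>\<^sub>L 'a" where
  "twist J s T t = cscale J (cis (s * t)) (T (- t))"

text \<open>\<open>generates T x w\<close> says that \<open>x\<close> is in the domain of \<open>A\<close> and \<open>w = \<i>Ax\<close>.\<close>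

definition generates :: "(real \<Rightarrow> 'a::real_normed_vector \<Rightarrow>\<^sub>L 'a) \<Rightarrow> 'a \<Rightarrow> 'a \<Rightarrow> bool" where
  "generates T x w \<longleftrightarrow> ((\<lambda>t. T t x) has_vector_derivative w) (at 0)"

text \<open>For \<open>twist J s T\<close> this is a lower bound for \<open>A - s\<close> on the
  domain of \<open>A\<close>: the generator is \<open>J\<close> times \<open>s - A\<close>, and
  \<open>J\<close> is isometric.\<close>

definition coercive :: "(real \<Rightarrow> 'a::real_normed_vector \<Rightarrow>\<^sub>L 'a) \<Rightarrow> real \<Rightarrow> bool" where
  "coercive T \<kappa> \<longleftrightarrow> \<kappa> > 0 \<and> (\<forall>x w. generates T x w \<longrightarrow> \<kappa> * norm x \<le> norm w)"

text \<open>A locale, so that facts proved for \<open>T\<close> can be interpreted for each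
  \<open>twist J s T\<close>; a spectral point \<open>s\<close> is thereby moved to 0.\<close>

locale isometry_group =
  fixes J :: "'a::banach \<Rightarrow>\<^sub>L 'a" and T :: "real \<Rightarrow> 'a \<Rightarrow>\<^sub>L 'a"
  assumes cs: "complex_structure J"
    and T_J: "T t (J x) = J (T t x)"
    and T_0 [simp]: "T 0 x = x"
    and T_add: "T (s + t) x = T s (T t x)"
    and T_cont: "continuous_on UNIV (\<lambda>t. T t x)"
    and norm_T [simp]: "norm (T t x) = norm x"
begin

sublocale cmult: bounded_bilinear "cmult J"
  by (rule bounded_bilinear_cmult[OF cs])

lemma T_cont' [continuous_intros]:
  "continuous_on S f \<Longrightarrow> continuous_on S (\<lambda>s. T (f s) x)"
  using continuous_on_compose2[OF T_cont] by blast

lemma T_cmult: "T t (cmult J c x) = cmult J c (T t x)"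
  by (simp add: cmult_def T_J blinfun.bilinear_simps)

lemma twist_apply: "twist J s T t x = cmult J (cis (s * t)) (T (- t) x)"
  by (simp add: twist_def cscale_apply)

lemma isometry_group_twist: "isometry_group J (twist J s T)"
proof
  fix t u x
  show "twist J s T t (J x) = J (twist J s T t x)"
    by (simp add: twist_apply T_J cmult_def blinfun.bilinear_simps)
  show "twist J s T 0 x = x" by (simp add: twist_apply)
  show "twist J s T (t + u) x = twist J s T t (twist J s T u x)"
    using T_add[of "-t" "-u" x]
    by (simp add: twist_apply T_cmult cmult_cmult[OF cs] cis_mult distrib_left)
  show "continuous_on UNIV (\<lambda>t. twist J s T t x)"
    unfolding twist_apply by (intro continuous_intros cmult.continuous_on)
  show "norm (twist J s T t x) = norm x"
    by (simp add: twist_apply norm_cmult[OF cs])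
qed (rule cs)

lemma twist_twist: "twist J s (twist J s T) = T"
  by (intro ext blinfun_eqI)
     (simp add: twist_def cscale_apply cmult_cmult[OF cs] cis_mult)

lemma generates_twist:
  assumes "generates T x w"
  shows "generates (twist J s T) x (s *\<^sub>R J x - w)"
proof -
  have T: "((\<lambda>t. T t x) has_vector_derivative w) (at (- 0))"
    using assms by (simp add: generates_def)
  have "(uminus has_vector_derivative (- 1 :: real)) (at 0)"
    by (auto intro!: derivative_eq_intros)
  from vector_diff_chain_at[OF this T]
  have "((\<lambda>t. T (- t) x) has_vector_derivative - w) (at 0)"
    by (simp add: o_def)
  moreover have "((\<lambda>t. cis (s * t)) has_vector_derivative (s *\<^sub>R \<i>)) (at 0)"
    by (auto intro!: derivative_eq_intros simp: has_vector_derivative_def scaleR_conv_of_real algebra_simps)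
  ultimately have "((\<lambda>t. cmult J (cis (s * t)) (T (- t) x)) has_vector_derivative
      cmult J (cis (s * 0)) (- w) + cmult J (s *\<^sub>R \<i>) (T (- 0) x)) (at 0)"
    by (intro cmult.has_vector_derivative)
  then show ?thesis
    by (simp add: generates_def twist_apply cmult_def)
qed

lemma generates_twist_iff: "generates (twist J s T) x v \<longleftrightarrow> generates T x (s *\<^sub>R J x - v)"
proof -
  interpret U: isometry_group J "twist J s T" by (rule isometry_group_twist)
  show ?thesis
    using generates_twist[of x "s *\<^sub>R J x - v" s] U.generates_twist[of x v s]
    by (auto simp: twist_twist)
qed

lemma generates_deriv:
  assumes "generates T x w"
  shows "((\<lambda>t. T t x) has_vector_derivative T t w) (at t within S)"
proof -
  have *: "((\<lambda>t. T t x) has_vector_derivative w) (at (t - t))"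
    using assms by (simp add: generates_def)
  have "((\<lambda>u. u - t) has_vector_derivative 1) (at t)"
    by (auto intro!: derivative_eq_intros)
  from vector_diff_chain_at[OF this *]
  have "((\<lambda>u. T (u - t) x) has_vector_derivative w) (at t)"
    by (simp add: o_def)
  from bounded_linear.has_vector_derivative[OF blinfun.bounded_linear_right this, of "T t"]
  have "((\<lambda>u. T u x) has_vector_derivative T t w) (at t)"
    by (simp flip: T_add)
  then show ?thesis by (rule has_vector_derivative_at_within)
qed

lemma generates_integral:
  assumes "generates T x w" "a \<le> b"
  shows "((\<lambda>t. T t w) has_integral (T b x - T a x)) {a..b}"
  by (rule fundamental_theorem_of_calculus[OF assms(2)]) (rule generates_deriv[OF assms(1)])

lemma generates_lipschitz:
  assumes "generates T x w"
  shows "norm (T t x - x) \<le> \<bar>t\<bar> * norm w"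
proof -
  have "norm (T t x - T 0 x) \<le> norm w * norm (t - 0)"
  proof (rule differentiable_bound[where S = UNIV and f' = "\<lambda>t h. h *\<^sub>R T t w"])
    show "onorm (\<lambda>h. h *\<^sub>R T t w) \<le> norm w" for t
      by (intro onorm_le) (simp add: mult.commute)
  qed (use generates_deriv[OF assms] in \<open>auto simp: has_vector_derivative_def\<close>)
  then show ?thesis by (simp add: mult.commute)
qed

text \<open>Used for averages of the orbit, which thereby preserve the domain of the possibly
  unbounded generator and commute with it.\<close>

lemma generates_bounded_linear:
  assumes "generates T x w" "bounded_linear B" "\<And>t x. B (T t x) = T t (B x)"
  shows "generates T (B x) (B w)"
  using bounded_linear.has_vector_derivative[OF assms(2) assms(1)[unfolded generates_def]] assms(3)
  by (simp add: generates_def)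

lemma bounded_linear_weighted:
  assumes k: "continuous_on {a..b} k"
  shows "bounded_linear (\<lambda>x. integral {a..b} (\<lambda>t. k t *\<^sub>R T t x))"
proof -
  have int: "(\<lambda>t. k t *\<^sub>R T t x) integrable_on {a..b}" for x
    by (intro integrable_continuous_real continuous_intros k)
  show ?thesis
  proof (rule bounded_linear_intro)
    show "norm (integral {a..b} (\<lambda>t. k t *\<^sub>R T t x)) \<le> norm x * integral {a..b} (\<lambda>t. \<bar>k t\<bar>)" for x
    proof -
      have "norm (integral {a..b} (\<lambda>t. k t *\<^sub>R T t x)) \<le> integral {a..b} (\<lambda>t. norm x * \<bar>k t\<bar>)"
        by (intro integral_norm_bound_integral int integrable_continuous_real continuous_intros k) simp
      then show ?thesis by simp
    qed
    fix r :: real and x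
    have "(\<lambda>t. k t *\<^sub>R T t (r *\<^sub>R x)) = (\<lambda>t. r *\<^sub>R (k t *\<^sub>R T t x))"
      by (simp add: fun_eq_iff blinfun.bilinear_simps mult.commute)
    then show "integral {a..b} (\<lambda>t. k t *\<^sub>R T t (r *\<^sub>R x)) = r *\<^sub>R integral {a..b} (\<lambda>t. k t *\<^sub>R T t x)"
      by (simp only: integral_cmul)
  qed (simp add: blinfun.bilinear_simps scaleR_add_right integral_add int)
qed

lemma weighted_commute:
  assumes k: "continuous_on {a..b} k"
  shows "integral {a..b} (\<lambda>t. k t *\<^sub>R T t (T u x)) = T u (integral {a..b} (\<lambda>t. k t *\<^sub>R T t x))"
proof -
  have "(\<lambda>t. k t *\<^sub>R T t x) integrable_on {a..b}"
    by (intro integrable_continuous_real continuous_intros k)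
  from integral_blinfun_apply[OF this, of "T u"] show ?thesis
    by (simp add: blinfun.bilinear_simps flip: T_add add.commute[of u])
qed

end

text \<open>Averaging with Fejer weights over a finite interval regularises the orbit integral, so that the functional
  calculus below needs neither resolvents nor improper vector-valued integrals.\<close>

definition cesaro :: "real \<Rightarrow> (real \<Rightarrow> 'a::real_normed_vector \<Rightarrow>\<^sub>L 'a) \<Rightarrow> 'a \<Rightarrow> 'a" where
  "cesaro N T x = integral {- N..N} (\<lambda>t. (1 - \<bar>t\<bar> / N) *\<^sub>R T t x)"

context isometry_group
begin

text \<open>The generator sends the orbit integral to \<open>T b x - T a x\<close>, whose norm is at
  most \<open>2 * norm x\<close> for every length of the interval.\<close>

lemma norm_orbit_integral_le:
  assumes gen: "generates T x w" and co: "coercive T \<kappa>" and "a \<le> b"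
  shows "norm (integral {a..b} (\<lambda>t. T t x)) \<le> 2 * norm x / \<kappa>"
proof -
  have "generates T (integral {a..b} (\<lambda>t. 1 *\<^sub>R T t x)) (integral {a..b} (\<lambda>t. 1 *\<^sub>R T t w))"
    by (intro generates_bounded_linear[OF gen bounded_linear_weighted] weighted_commute continuous_on_const)
  then have "\<kappa> * norm (integral {a..b} (\<lambda>t. T t x)) \<le> norm (integral {a..b} (\<lambda>t. T t w))"
    using co by (simp add: coercive_def)
  also have "\<dots> = norm (T b x - T a x)"
    using integral_unique[OF generates_integral[OF gen \<open>a \<le> b\<close>]] by simp
  also have "\<dots> \<le> 2 * norm x"
    using norm_triangle_ineq4[of "T b x" "T a x"] by simp
  finally show ?thesis
    using co by (simp add: coercive_def field_simps)
qed

text \<open>Integration by parts: the tent weight is 0 at both ends and the boundary terms at 0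
  cancel, so only the slopes \<open>1 / N\<close> and \<open>- 1 / N\<close> remain.\<close>

lemma cesaro_generates:
  assumes gen: "generates T x w" and "N > 0"
  shows "cesaro N T w = (1 / N) *\<^sub>R (integral {0..N} (\<lambda>t. T t x) - integral {- N..0} (\<lambda>t. T t x))"
proof -
  have int: "(\<lambda>t. k t *\<^sub>R T t y) integrable_on {a..b}" if "continuous_on {a..b} k" for k a b y
    by (intro integrable_continuous_real continuous_intros that)
  have deriv: "((\<lambda>t. (1 + c * t) *\<^sub>R T t x) has_vector_derivative (1 + c * t) *\<^sub>R T t w + c *\<^sub>R T t x) (at t within S)" for c t S
  proof -
    have "((\<lambda>t. 1 + c * t) has_vector_derivative c) (at t within S)"
      by (auto intro!: derivative_eq_intros)
    from bounded_bilinear.has_vector_derivative[OF bounded_bilinear_scaleR this generates_deriv[OF gen]]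
    show ?thesis .
  qed
  have parts: "integral {a..b} (\<lambda>t. (1 + c * t) *\<^sub>R T t w) =
      (1 + c * b) *\<^sub>R T b x - (1 + c * a) *\<^sub>R T a x - c *\<^sub>R integral {a..b} (\<lambda>t. T t x)" if "a \<le> b" for a b c
  proof -
    have "((\<lambda>t. (1 + c * t) *\<^sub>R T t w + c *\<^sub>R T t x) has_integral
        ((1 + c * b) *\<^sub>R T b x - (1 + c * a) *\<^sub>R T a x)) {a..b}"
      by (rule fundamental_theorem_of_calculus[OF that deriv])
    then have "integral {a..b} (\<lambda>t. (1 + c * t) *\<^sub>R T t w) + integral {a..b} (\<lambda>t. c *\<^sub>R T t x)
        = (1 + c * b) *\<^sub>R T b x - (1 + c * a) *\<^sub>R T a x"
      by (subst integral_add[symmetric]) (auto intro!: int continuous_intros)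
    then show ?thesis by (simp add: algebra_simps)
  qed
  have "cesaro N T w = integral {- N..0} (\<lambda>t. (1 - \<bar>t\<bar> / N) *\<^sub>R T t w) + integral {0..N} (\<lambda>t. (1 - \<bar>t\<bar> / N) *\<^sub>R T t w)"
    unfolding cesaro_def using \<open>N > 0\<close>
    by (intro Henstock_Kurzweil_Integration.integral_combine[symmetric] int continuous_intros) auto
  also have "integral {- N..0} (\<lambda>t. (1 - \<bar>t\<bar> / N) *\<^sub>R T t w) = integral {- N..0} (\<lambda>t. (1 + (1 / N) * t) *\<^sub>R T t w)"
    by (rule integral_cong) auto
  also have "integral {0..N} (\<lambda>t. (1 - \<bar>t\<bar> / N) *\<^sub>R T t w) = integral {0..N} (\<lambda>t. (1 + (- 1 / N) * t) *\<^sub>R T t w)"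
    by (rule integral_cong) auto
  finally show ?thesis
    using \<open>N > 0\<close> parts[of "- N" 0 "1 / N"] parts[of 0 N "- 1 / N"] by (simp add: scaleR_diff_right)
qed

text \<open>Coercivity is used twice, to pass from \<open>x\<close> to \<open>w\<close> and to bound
  the two orbit integrals left by \<open>cesaro_generates\<close>; hence the square of
  \<open>\<kappa>\<close>.\<close>

lemma norm_cesaro_le:
  assumes gen: "generates T x w" and co: "coercive T \<kappa>" and "N > 0"
  shows "norm (cesaro N T x) \<le> 4 * norm x / (\<kappa>\<^sup>2 * N)"
proof -
  have \<kappa>: "\<kappa> > 0" using co by (simp add: coercive_def)
  have cont: "continuous_on {- N..N} (\<lambda>t. 1 - \<bar>t\<bar> / N)"
    using \<open>N > 0\<close> by (intro continuous_intros) auto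
  have "generates T (cesaro N T x) (cesaro N T w)"
    unfolding cesaro_def
    by (intro generates_bounded_linear[OF gen bounded_linear_weighted[OF cont]] weighted_commute[OF cont])
  then have "\<kappa> * norm (cesaro N T x) \<le> norm (cesaro N T w)"
    using co by (simp add: coercive_def)
  also have "\<dots> \<le> (1 / N) * (norm (integral {0..N} (\<lambda>t. T t x)) + norm (integral {- N..0} (\<lambda>t. T t x)))"
    unfolding cesaro_generates[OF gen \<open>N > 0\<close>] using \<open>N > 0\<close>
    by (simp add: divide_right_mono norm_triangle_ineq4)
  also have "\<dots> \<le> (1 / N) * (2 * norm x / \<kappa> + 2 * norm x / \<kappa>)"
    using \<open>N > 0\<close> by (intro mult_left_mono add_mono norm_orbit_integral_le[OF gen co]) auto
  finally have "\<kappa> * norm (cesaro N T x) \<le> (1 / N) * (4 * norm x / \<kappa>)" by simp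
  then show ?thesis
    using \<kappa> \<open>N > 0\<close> by (simp add: field_simps power2_eq_square)
qed

text \<open>Fubini for a continuous integrand on a rectangle: the twist puts
  \<open>cis (s * t)\<close> under the integral over \<open>s\<close>, which builds the transform
  \<open>F\<close> of \<open>g\<close>.\<close>

lemma integral_twist_swap:
  fixes g k :: "real \<Rightarrow> real"
  assumes g: "continuous_on {- M..M} g" and k: "continuous_on {a..b} k"
  defines "F \<equiv> \<lambda>t. integral {- M..M} (\<lambda>s. g s *\<^sub>R cis (s * t))"
  shows "(\<lambda>s. g s *\<^sub>R integral {a..b} (\<lambda>t. k t *\<^sub>R twist J s T t x)) integrable_on {- M..M}"
    and "integral {- M..M} (\<lambda>s. g s *\<^sub>R integral {a..b} (\<lambda>t. k t *\<^sub>R twist J s T t x)) =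
      integral {a..b} (\<lambda>t. k t *\<^sub>R cmult J (F t) (T (- t) x))"
proof -
  let ?h = "\<lambda>s t. g s *\<^sub>R k t *\<^sub>R twist J s T t x"
  have cont: "continuous_on (cbox (- M, a) (M, b)) (\<lambda>(s, t). ?h s t)"
    unfolding split_def twist_apply
    by (intro continuous_intros cmult.continuous_on continuous_on_compose2[OF g] continuous_on_compose2[OF k])
       (auto simp: cbox_Pair_eq)
  have inner: "g s *\<^sub>R integral {a..b} (\<lambda>t. k t *\<^sub>R twist J s T t x) = integral {a..b} (?h s)" for s
    by (simp only: integral_cmul)
  have "(\<lambda>s. integral (cbox a b) (?h s)) integrable_on cbox (- M) M"
    by (rule integrable_continuous, rule integral_continuous_on_param, rule cont[unfolded cbox_Pair_eq])
  then show "(\<lambda>s. g s *\<^sub>R integral {a..b} (\<lambda>t. k t *\<^sub>R twist J s T t x)) integrable_on {- M..M}"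
    by (simp add: inner)
  have "integral {- M..M} (\<lambda>s. g s *\<^sub>R integral {a..b} (\<lambda>t. k t *\<^sub>R twist J s T t x)) =
      integral {a..b} (\<lambda>t. integral {- M..M} (\<lambda>s. ?h s t))"
    unfolding inner using integral_swap_continuous[OF cont] by simp
  also have "\<dots> = integral {a..b} (\<lambda>t. k t *\<^sub>R cmult J (F t) (T (- t) x))"
  proof (rule integral_cong)
    fix t assume "t \<in> {a..b}"
    have int: "(\<lambda>s. g s *\<^sub>R cis (s * t)) integrable_on {- M..M}"
      by (intro integrable_continuous_real continuous_intros g)
    have "?h s t = k t *\<^sub>R cmult J (g s *\<^sub>R cis (s * t)) (T (- t) x)" for s
      by (simp add: twist_apply cmult.scaleR_left mult.commute)
    then have "integral {- M..M} (\<lambda>s. ?h s t) = k t *\<^sub>R integral {- M..M} (\<lambda>s. cmult J (g s *\<^sub>R cis (s * t)) (T (- t) x))"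
      by simp
    also have "integral {- M..M} (\<lambda>s. cmult J (g s *\<^sub>R cis (s * t)) (T (- t) x)) = cmult J (F t) (T (- t) x)"
      using integral_linear[OF int cmult.bounded_linear_left] by (simp add: F_def o_def)
    finally show "integral {- M..M} (\<lambda>s. ?h s t) = k t *\<^sub>R cmult J (F t) (T (- t) x)" .
  qed
  finally show "integral {- M..M} (\<lambda>s. g s *\<^sub>R integral {a..b} (\<lambda>t. k t *\<^sub>R twist J s T t x)) =
      integral {a..b} (\<lambda>t. k t *\<^sub>R cmult J (F t) (T (- t) x))" .
qed

end

lemma norm_mult_integrable:
  fixes f :: "real \<Rightarrow> complex"
  assumes f: "f absolutely_integrable_on UNIV" and k: "continuous_on UNIV k" "\<And>t. \<bar>k t\<bar> \<le> M"
  shows "(\<lambda>t. norm (f t) * k t) integrable_on UNIV"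
  using k by (intro integrable_bilinear_continuous[OF bounded_bilinear_mult _ k(1), of _ M] absolutely_integrable_norm[OF f, unfolded o_def]) auto

section \<open>Convergence of the Cesaro means to the module action\<close>

context isometry_group
begin

lemma l1act_integrable:
  assumes "f absolutely_integrable_on UNIV"
  shows "(\<lambda>t. cmult J (f t) (T (- t) x)) integrable_on UNIV"
  by (rule integrable_bilinear_continuous[OF cmult.bounded_bilinear_axioms assms, of _ "norm x"])
     (auto intro!: continuous_intros)

lemma norm_l1act_le:
  assumes f: "f absolutely_integrable_on UNIV"
  shows "norm (l1act J T f x) \<le> integral UNIV (\<lambda>t. norm (f t)) * norm x"
proof -
  have "norm (l1act J T f x) \<le> integral UNIV (\<lambda>t. norm (f t) * norm x)"
    unfolding l1act_def using f
    by (intro integral_norm_bound_integral l1act_integrable integrable_on_mult_left)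
       (auto simp: absolutely_integrable_on_def norm_cmult[OF cs])
  then show ?thesis by simp
qed

text \<open>The weights tend to 1 pointwise. The error is an integral of \<open>f\<close> against
  \<open>1 - k\<close>, and dominated convergence is applied to the integral of its norm.\<close>

lemma cesaro_tendsto_l1act:
  assumes f: "f absolutely_integrable_on UNIV"
  shows "(\<lambda>n. integral {- real n..real n} (\<lambda>t. (1 - \<bar>t\<bar> / real n) *\<^sub>R cmult J (f t) (T (- t) x)))
    \<longlonglongrightarrow> l1act J T f x"
proof -
  \<comment> \<open>The cut-off at 0 extends the weight continuously to the line. Division by 0
    makes \<open>k 0\<close> constantly 1, so the bounds hold for all \<open>n\<close>.\<close>
  define k where "k n t = max 0 (1 - \<bar>t\<bar> / real n)" for n :: nat and t
  have k_cont: "continuous_on UNIV (k n)" for n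
    unfolding k_def by (cases "n = 0") (auto intro!: continuous_intros)
  have k01: "0 \<le> k n t" "k n t \<le> 1" for n t
    by (auto simp: k_def)
  have int1: "(\<lambda>t. cmult J (f t) ((1 - k n t) *\<^sub>R T (- t) x)) integrable_on UNIV" for n
  proof (rule integrable_bilinear_continuous[OF cmult.bounded_bilinear_axioms f, of _ "norm x"])
    show "norm ((1 - k n t) *\<^sub>R T (- t) x) \<le> norm x" for t
      using k01[of n t] by (simp add: mult_left_le_one_le)
  qed (auto intro!: continuous_intros k_cont)
  have int2: "(\<lambda>t. norm (f t) * (1 - k n t)) integrable_on UNIV" for n
    using k01 by (intro norm_mult_integrable[OF f, of _ 1] continuous_intros k_cont) (auto simp: abs_le_iff)
  have eq: "integral {- real n..real n} (\<lambda>t. (1 - \<bar>t\<bar> / real n) *\<^sub>R cmult J (f t) (T (- t) x))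
     = l1act J T f x - integral UNIV (\<lambda>t. cmult J (f t) ((1 - k n t) *\<^sub>R T (- t) x))" if "n > 0" for n
  proof -
    have "integral {- real n..real n} (\<lambda>t. (1 - \<bar>t\<bar> / real n) *\<^sub>R cmult J (f t) (T (- t) x))
      = integral UNIV (\<lambda>t. cmult J (f t) (T (- t) x) - cmult J (f t) ((1 - k n t) *\<^sub>R T (- t) x))"
      unfolding integral_restrict_UNIV[of "{- real n..real n}", symmetric]
    proof (rule integral_cong)
      fix t
      show "(if t \<in> {- real n..real n} then (1 - \<bar>t\<bar> / real n) *\<^sub>R cmult J (f t) (T (- t) x) else 0) =
        cmult J (f t) (T (- t) x) - cmult J (f t) ((1 - k n t) *\<^sub>R T (- t) x)"
      proof -
        have "cmult J (f t) (T (- t) x) - cmult J (f t) ((1 - k n t) *\<^sub>R T (- t) x) = k n t *\<^sub>R cmult J (f t) (T (- t) x)"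
          by (simp add: cmult.scaleR_right cmult.diff_right scaleR_diff_left)
        moreover have "k n t = (if t \<in> {- real n..real n} then 1 - \<bar>t\<bar> / real n else 0)"
          using that by (auto simp: k_def max_def field_simps)
        ultimately show ?thesis by simp
      qed
    qed
    then show ?thesis by (simp add: l1act_def integral_diff int1 l1act_integrable[OF f])
  qed
  have "(\<lambda>n. integral UNIV (\<lambda>t. norm (f t) * (1 - k n t))) \<longlonglongrightarrow> integral UNIV (\<lambda>t::real. 0)"
  proof (rule dominated_convergence(2)[where h = "\<lambda>t. norm (f t)"])
    show "(\<lambda>t. norm (f t) * (1 - k n t)) integrable_on UNIV" for n by (rule int2)
    show "(\<lambda>t. norm (f t)) integrable_on UNIV" using f by (simp add: absolutely_integrable_on_def)
    show "norm (norm (f t) * (1 - k n t)) \<le> norm (f t)" for n t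
      using k01[of n t] by (simp add: mult_left_le)
    show "(\<lambda>n. norm (f t) * (1 - k n t)) \<longlonglongrightarrow> 0" for t
    proof -
      have "(\<lambda>n. norm (f t) * (1 - max 0 (1 - \<bar>t\<bar> * inverse (real n)))) \<longlonglongrightarrow> norm (f t) * (1 - max 0 (1 - \<bar>t\<bar> * 0))"
        by (intro tendsto_intros lim_inverse_n)
      then show ?thesis by (simp add: k_def divide_inverse)
    qed
  qed
  then have "(\<lambda>n. integral UNIV (\<lambda>t. norm (f t) * (1 - k n t)) * norm x) \<longlonglongrightarrow> 0"
    using tendsto_mult_left_zero by fastforce
  then have "(\<lambda>n. integral UNIV (\<lambda>t. cmult J (f t) ((1 - k n t) *\<^sub>R T (- t) x))) \<longlonglongrightarrow> 0"
  proof (rule Lim_null_comparison[rotated], intro always_eventually allI)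
    fix n
    have "norm (integral UNIV (\<lambda>t. cmult J (f t) ((1 - k n t) *\<^sub>R T (- t) x))) \<le>
      integral UNIV (\<lambda>t. norm (f t) * (1 - k n t) * norm x)"
      by (intro integral_norm_bound_integral int1 integrable_on_mult_left int2)
         (use k01[of n] in \<open>simp add: norm_cmult[OF cs]\<close>)
    then show "norm (integral UNIV (\<lambda>t. cmult J (f t) ((1 - k n t) *\<^sub>R T (- t) x))) \<le>
      integral UNIV (\<lambda>t. norm (f t) * (1 - k n t)) * norm x" by simp
  qed
  from tendsto_diff[OF tendsto_const this, of "l1act J T f x"]
  have "(\<lambda>n. l1act J T f x - integral UNIV (\<lambda>t. cmult J (f t) ((1 - k n t) *\<^sub>R T (- t) x))) \<longlonglongrightarrow> l1act J T f x"
    by simp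
  then show ?thesis
    by (rule Lim_transform_eventually) (rule eventually_sequentiallyI[of 1], simp add: eq)
qed

lemma cesaro_twist_tendsto_l1act:
  fixes g :: "real \<Rightarrow> real"
  assumes g: "continuous_on {- M..M} g"
    and F: "(\<lambda>t. integral {- M..M} (\<lambda>s. g s *\<^sub>R cis (s * t))) absolutely_integrable_on UNIV" (is "?F absolutely_integrable_on _")
  shows "(\<lambda>n. integral {- M..M} (\<lambda>s. g s *\<^sub>R cesaro (real n) (twist J s T) x)) \<longlonglongrightarrow> l1act J T ?F x"
proof -
  have "integral {- M..M} (\<lambda>s. g s *\<^sub>R cesaro (real n) (twist J s T) x) =
      integral {- real n..real n} (\<lambda>t. (1 - \<bar>t\<bar> / real n) *\<^sub>R cmult J (?F t) (T (- t) x))" if "n > 0" for n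
    unfolding cesaro_def using that by (intro integral_twist_swap g continuous_intros) auto
  then show ?thesis
    by (intro Lim_transform_eventually[OF cesaro_tendsto_l1act[OF F]] eventually_sequentiallyI[of 1]) simp
qed

text \<open>This turns multiplication of \<open>g\<close> by \<open>s\<close> into an application of
  \<open>A\<close>. By \<open>cesaro_generates\<close> the means are \<open>1 / n\<close> times
  orbit integrals, which after integration against \<open>g\<close> are bounded through the L1 norm
  of the transform of \<open>g\<close>. No lower bound for \<open>A - s\<close> is involved, so
  \<open>g\<close> may live on the spectrum.\<close>

lemma cesaro_twist_generates_tendsto_0:
  fixes g :: "real \<Rightarrow> real"
  assumes gen: "generates T x w" and g: "continuous_on {- M..M} g"
    and F: "(\<lambda>t. integral {- M..M} (\<lambda>s. g s *\<^sub>R cis (s * t))) absolutely_integrable_on UNIV" (is "?F absolutely_integrable_on _")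
  shows "(\<lambda>n. integral {- M..M} (\<lambda>s. g s *\<^sub>R cesaro (real n) (twist J s T) (s *\<^sub>R J x - w))) \<longlonglongrightarrow> 0"
proof -
  define C where "C = integral UNIV (\<lambda>t. norm (?F t)) * norm x"
  have swap: "(\<lambda>s. g s *\<^sub>R integral {a..b} (\<lambda>t. twist J s T t x)) integrable_on {- M..M}"
    "integral {- M..M} (\<lambda>s. g s *\<^sub>R integral {a..b} (\<lambda>t. twist J s T t x)) =
     integral {a..b} (\<lambda>t. cmult J (?F t) (T (- t) x))" for a b
    using integral_twist_swap[OF g continuous_on_const[of "{a..b}" "1 :: real"], of x] by (simp_all only: scaleR_one)
  have bound: "norm (integral {a..b} (\<lambda>t. cmult J (?F t) (T (- t) x))) \<le> C" for a b
  proof -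
    have sub: "h integrable_on {a..b}" if "h integrable_on UNIV" for h :: "real \<Rightarrow> 'z::banach"
      using integrable_on_subcbox[OF that, of a b] by simp
    have Fn: "(\<lambda>t. norm (?F t) * norm x) integrable_on UNIV"
      using F by (intro integrable_on_mult_left) (simp add: absolutely_integrable_on_def)
    have "norm (integral {a..b} (\<lambda>t. cmult J (?F t) (T (- t) x))) \<le> integral {a..b} (\<lambda>t. norm (?F t) * norm x)"
      by (intro integral_norm_bound_integral sub Fn l1act_integrable[OF F]) (simp add: norm_cmult[OF cs])
    also have "\<dots> \<le> integral UNIV (\<lambda>t. norm (?F t) * norm x)"
      by (intro integral_subset_le sub Fn) auto
    finally show ?thesis by (simp add: C_def)
  qed
  have bound_n: "norm (integral {- M..M} (\<lambda>s. g s *\<^sub>R cesaro (real n) (twist J s T) (s *\<^sub>R J x - w))) \<le> inverse (real n) * (C + C)"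
    if "n > 0" for n
  proof -
    have "cesaro (real n) (twist J s T) (s *\<^sub>R J x - w) = inverse (real n) *\<^sub>R
        (integral {0..real n} (\<lambda>t. twist J s T t x) - integral {- real n..0} (\<lambda>t. twist J s T t x))" for s
    proof -
      interpret U: isometry_group J "twist J s T" by (rule isometry_group_twist)
      show ?thesis using U.cesaro_generates[OF generates_twist[OF gen], of "real n"] that
        by (simp add: inverse_eq_divide)
    qed
    then have "(\<lambda>s. g s *\<^sub>R cesaro (real n) (twist J s T) (s *\<^sub>R J x - w)) = (\<lambda>s. inverse (real n) *\<^sub>R
        (g s *\<^sub>R integral {0..real n} (\<lambda>t. twist J s T t x) - g s *\<^sub>R integral {- real n..0} (\<lambda>t. twist J s T t x)))"
      by (simp add: fun_eq_iff scaleR_diff_right mult.commute)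
    then have "integral {- M..M} (\<lambda>s. g s *\<^sub>R cesaro (real n) (twist J s T) (s *\<^sub>R J x - w)) = inverse (real n) *\<^sub>R
        (integral {0..real n} (\<lambda>t. cmult J (?F t) (T (- t) x)) - integral {- real n..0} (\<lambda>t. cmult J (?F t) (T (- t) x)))"
      by (simp only: integral_cmul integral_diff[OF swap(1)[of 0 "real n"] swap(1)[of "- real n" 0]] swap(2))
    moreover have "norm (integral {0..real n} (\<lambda>t. cmult J (?F t) (T (- t) x)) - integral {- real n..0} (\<lambda>t. cmult J (?F t) (T (- t) x))) \<le> C + C"
      by (rule norm_triangle_le_diff, rule add_mono) (rule bound)+
    ultimately show ?thesis by (simp add: mult_left_mono)
  qed
  have lim: "(\<lambda>n. inverse (real n) * (C + C)) \<longlonglongrightarrow> 0"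
    by (intro tendsto_mult_left_zero lim_inverse_n)
  show ?thesis
    by (rule Lim_null_comparison[OF _ lim], rule eventually_sequentiallyI[of 1], rule bound_n) simp
qed


text \<open>The bound of \<open>norm_cesaro_le\<close> is uniform in \<open>s\<close> where
  \<open>g\<close> is nonzero, so the means are of order \<open>1 / n\<close> there. With
  \<open>cesaro_twist_tendsto_l1act\<close> it follows that values of \<open>g\<close> away from the
  spectrum have no effect.\<close>

lemma cesaro_twist_tendsto_0:
  fixes g :: "real \<Rightarrow> real"
  assumes gen: "generates T x w" and g: "continuous_on {- M..M} g"
    and co: "\<And>s. s \<in> {- M..M} \<Longrightarrow> g s \<noteq> 0 \<Longrightarrow> coercive (twist J s T) \<kappa>"
  shows "(\<lambda>n. integral {- M..M} (\<lambda>s. g s *\<^sub>R cesaro (real n) (twist J s T) x)) \<longlonglongrightarrow> 0"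
proof -
  define C where "C = integral {- M..M} (\<lambda>s. \<bar>g s\<bar>) * (4 * norm x / \<kappa>\<^sup>2)"
  have bound_n: "norm (integral {- M..M} (\<lambda>s. g s *\<^sub>R cesaro (real n) (twist J s T) x)) \<le> inverse (real n) * C"
    if "n > 0" for n
  proof -
    have "norm (integral {- M..M} (\<lambda>s. g s *\<^sub>R cesaro (real n) (twist J s T) x)) \<le>
       integral {- M..M} (\<lambda>s. \<bar>g s\<bar> * (4 * norm x / (\<kappa>\<^sup>2 * real n)))"
    proof (rule integral_norm_bound_integral)
      show "(\<lambda>s. g s *\<^sub>R cesaro (real n) (twist J s T) x) integrable_on {- M..M}"
        unfolding cesaro_def using that by (intro integral_twist_swap g continuous_intros) auto
      show "(\<lambda>s. \<bar>g s\<bar> * (4 * norm x / (\<kappa>\<^sup>2 * real n))) integrable_on {- M..M}"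
        by (intro integrable_continuous_real continuous_intros g)
      fix s assume s: "s \<in> {- M..M}"
      interpret U: isometry_group J "twist J s T" by (rule isometry_group_twist)
      show "norm (g s *\<^sub>R cesaro (real n) (twist J s T) x) \<le> \<bar>g s\<bar> * (4 * norm x / (\<kappa>\<^sup>2 * real n))"
        using mult_left_mono[OF U.norm_cesaro_le[OF generates_twist[OF gen] co[OF s], of "real n"] abs_ge_zero[of "g s"]] that
        by (cases "g s = 0") (simp_all only: norm_scaleR, simp_all)
    qed
    then show ?thesis by (simp add: C_def field_simps)
  qed
  have lim: "(\<lambda>n. inverse (real n) * C) \<longlonglongrightarrow> 0"
    by (intro tendsto_mult_left_zero lim_inverse_n)
  show ?thesis
    by (rule Lim_null_comparison[OF _ lim], rule eventually_sequentiallyI[of 1], rule bound_n) simp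
qed

section \<open>Lower bounds for \<open>A - s\<close> off the Beurling spectrum\<close>

text \<open>Moving the spectral point perturbs the generator by a multiple of the isometry
  \<open>J\<close>, of size at most half the lower bound.\<close>

lemma coercive_twist_near:
  assumes "coercive (twist J \<gamma> T) \<kappa>" "\<bar>s - \<gamma>\<bar> \<le> \<kappa> / 2"
  shows "coercive (twist J s T) (\<kappa> / 2)"
  unfolding coercive_def
proof (intro conjI allI impI)
  show "0 < \<kappa> / 2" using assms(1) by (simp add: coercive_def)
  fix x v assume "generates (twist J s T) x v"
  then have "generates (twist J \<gamma> T) x (\<gamma> *\<^sub>R J x - (s *\<^sub>R J x - v))"
    by (simp add: generates_twist_iff)
  then have "\<kappa> * norm x \<le> norm (\<gamma> *\<^sub>R J x - (s *\<^sub>R J x - v))"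
    using assms(1) by (simp add: coercive_def)
  also have "\<gamma> *\<^sub>R J x - (s *\<^sub>R J x - v) = v - (s - \<gamma>) *\<^sub>R J x"
    by (simp add: algebra_simps)
  also have "norm \<dots> \<le> norm v + \<bar>s - \<gamma>\<bar> * norm x"
    using norm_triangle_ineq4[of v "(s - \<gamma>) *\<^sub>R J x"] by (simp add: norm_J[OF cs])
  also have "\<dots> \<le> norm v + \<kappa> / 2 * norm x"
    using mult_right_mono[OF assms(2) norm_ge_zero[of x]] by simp
  finally show "\<kappa> / 2 * norm x \<le> norm v" by (simp add: algebra_simps)
qed



text \<open>If \<open>A - \<gamma>\<close> is not bounded below, then \<open>T t x\<close> is close to \<open>exp (\<i>\<gamma>t) x\<close> for suitable unit vectors \<open>x\<close>,
  so that \<open>f x\<close> is close to the multiple of \<open>x\<close> by the Fourier transform of \<open>f\<close> at \<open>\<gamma>\<close>.\<close>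

lemma coercive_off_beurling_spectrum:
  assumes "\<gamma> \<notin> beurling_spectrum J T UNIV"
  obtains \<kappa> where "coercive (twist J \<gamma> T) \<kappa>"
proof (rule ccontr)
  assume no: "\<not> thesis"
  obtain f where f: "f absolutely_integrable_on UNIV" and ann: "\<And>x. l1act J T f x = 0" and nz: "fourier f \<gamma> \<noteq> 0"
    using assms unfolding beurling_spectrum_def by blast
  \<comment> \<open>Majorant of the distance from \<open>T (- t) x\<close> to the scalar multiple of
    \<open>x\<close>, relative to \<open>norm x\<close>: 2 is the trivial bound for isometries, the
    other entry the Lipschitz bound for an approximate eigenvector.\<close>
  define b where "b n t = min 2 (\<bar>t\<bar> * inverse (real (Suc n)))" for n t
  have int: "(\<lambda>t. norm (f t) * b n t) integrable_on UNIV" for n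
    unfolding b_def by (intro norm_mult_integrable[OF f, of _ 2] continuous_intros) auto
  have "norm (fourier f \<gamma>) \<le> integral UNIV (\<lambda>t. norm (f t) * b n t)" for n
  proof -
    \<comment> \<open>Failure of coercivity at every level supplies, for each \<open>n\<close>, a
      nonzero \<open>x\<close> that is an eigenvector up to the relative error
      \<open>1 / (n + 1)\<close>.\<close>
    have "\<not> coercive (twist J \<gamma> T) (inverse (real (Suc n)))" using no that by blast
    then obtain x v where gen: "generates (twist J \<gamma> T) x v" and small: "norm v < inverse (real (Suc n)) * norm x"
      unfolding coercive_def by (auto simp: not_le)
    interpret U: isometry_group J "twist J \<gamma> T" by (rule isometry_group_twist)
    have x: "norm x > 0" using small norm_ge_zero[of v] by (cases "x = 0") auto
    let ?e = "\<lambda>t. exp (- \<i> * of_real (t * \<gamma>))"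
    have e: "?e t = cis (- (\<gamma> * t))" for t by (simp add: cis_conv_exp algebra_simps)
    have close: "norm (T (- t) x - cmult J (?e t) x) \<le> b n t * norm x" for t
    proof -
      have "T (- t) x = cmult J (?e t) (twist J \<gamma> T t x)"
        unfolding e by (simp add: twist_apply cmult_cmult[OF cs] cis_mult)
      then have "norm (T (- t) x - cmult J (?e t) x) = norm (cmult J (?e t) (twist J \<gamma> T t x - x))"
        by (simp only: cmult.diff_right)
      then have "norm (T (- t) x - cmult J (?e t) x) = norm (twist J \<gamma> T t x - x)"
        unfolding e by (simp add: norm_cmult[OF cs])
      moreover have "norm (twist J \<gamma> T t x - x) \<le> 2 * norm x"
        using norm_triangle_ineq4[of "twist J \<gamma> T t x" x] by simp
      moreover have "norm (twist J \<gamma> T t x - x) \<le> \<bar>t\<bar> * inverse (real (Suc n)) * norm x"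
      proof -
        have "norm (twist J \<gamma> T t x - x) \<le> \<bar>t\<bar> * norm v" by (rule U.generates_lipschitz[OF gen])
        also have "\<dots> \<le> \<bar>t\<bar> * (inverse (real (Suc n)) * norm x)" using small by (intro mult_left_mono) auto
        finally show ?thesis by (simp only: mult.assoc)
      qed
      ultimately show ?thesis unfolding b_def min_def by presburger
    qed
    have fe: "(\<lambda>t. f t * ?e t) integrable_on UNIV"
      by (rule integrable_bilinear_continuous[OF bounded_bilinear_mult f, of _ 1]) (auto intro!: continuous_intros)
    have fex: "(\<lambda>t. cmult J (f t * ?e t) x) integrable_on UNIV"
      using integrable_linear[OF fe cmult.bounded_linear_left[of x]] by (simp only: o_def)
    have "cmult J (fourier f \<gamma>) x = integral UNIV (\<lambda>t. cmult J (f t * ?e t) x)"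
      using integral_linear[OF fe cmult.bounded_linear_left[of x]] by (simp only: o_def fourier_def)
    \<comment> \<open>As \<open>f\<close> annihilates the space, \<open>l1act J T f x\<close> can be
      inserted freely; the integrand becomes \<open>f\<close> times the distance just
      estimated.\<close>
    also have "\<dots> = - (l1act J T f x - integral UNIV (\<lambda>t. cmult J (f t * ?e t) x))" by (simp only: ann) simp
    also have "l1act J T f x - integral UNIV (\<lambda>t. cmult J (f t * ?e t) x) =
        integral UNIV (\<lambda>t. cmult J (f t) (T (- t) x) - cmult J (f t * ?e t) x)"
      unfolding l1act_def by (rule integral_diff[symmetric, OF l1act_integrable[OF f] fex])
    finally have "norm (cmult J (fourier f \<gamma>) x) = norm (integral UNIV (\<lambda>t. cmult J (f t) (T (- t) x) - cmult J (f t * ?e t) x))"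
      by (simp only: norm_minus_cancel)
    also have "\<dots> \<le> integral UNIV (\<lambda>t. norm (f t) * b n t * norm x)"
    proof (rule integral_norm_bound_integral)
      show "(\<lambda>t. cmult J (f t) (T (- t) x) - cmult J (f t * ?e t) x) integrable_on UNIV"
        by (rule integrable_diff[OF l1act_integrable[OF f] fex])
      show "(\<lambda>t. norm (f t) * b n t * norm x) integrable_on UNIV"
        by (rule integrable_on_mult_left[OF int])
      fix t
      have "cmult J (f t) (T (- t) x) - cmult J (f t * ?e t) x = cmult J (f t) (T (- t) x - cmult J (?e t) x)"
        by (simp only: cmult.diff_right cmult_cmult[OF cs])
      then show "norm (cmult J (f t) (T (- t) x) - cmult J (f t * ?e t) x) \<le> norm (f t) * b n t * norm x"
        using mult_left_mono[OF close[of t], of "norm (f t)"] by (simp only: norm_cmult[OF cs] mult.assoc norm_ge_zero)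
    qed
    finally show ?thesis using x by (simp add: norm_cmult[OF cs])
  qed
  moreover have "(\<lambda>n. integral UNIV (\<lambda>t. norm (f t) * b n t)) \<longlonglongrightarrow> integral UNIV (\<lambda>t::real. 0)"
  proof (rule dominated_convergence(2)[where h = "\<lambda>t. norm (f t) * 2"])
    show "(\<lambda>t. norm (f t) * b n t) integrable_on UNIV" for n by (rule int)
    show "(\<lambda>t. norm (f t) * 2) integrable_on UNIV"
      using f by (intro integrable_on_mult_left) (simp add: absolutely_integrable_on_def)
    show "norm (norm (f t) * b n t) \<le> norm (f t) * 2" for n t
      unfolding real_norm_def abs_mult by (intro mult_mono) (auto simp: b_def)
    show "(\<lambda>n. norm (f t) * b n t) \<longlonglongrightarrow> 0" for t
    proof -
      have "(\<lambda>n. norm (f t) * min 2 (\<bar>t\<bar> * inverse (real (Suc n)))) \<longlonglongrightarrow> norm (f t) * min 2 (\<bar>t\<bar> * 0)"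
        by (intro tendsto_intros LIMSEQ_inverse_real_of_nat)
      then show ?thesis by (simp add: b_def)
    qed
  qed
  ultimately have "norm (fourier f \<gamma>) \<le> integral UNIV (\<lambda>t::real. 0)"
    using LIMSEQ_le_const by blast
  then show False using nz by simp
qed

lemma coercive_compact:
  assumes K: "compact K" and disj: "K \<inter> beurling_spectrum J T UNIV = {}"
  obtains \<kappa> where "\<And>s. s \<in> K \<Longrightarrow> coercive (twist J s T) \<kappa>"
proof -
  have "\<forall>\<gamma>\<in>K. \<exists>\<kappa>. coercive (twist J \<gamma> T) \<kappa>"
    using coercive_off_beurling_spectrum disj by blast
  then obtain k where k: "\<And>\<gamma>. \<gamma> \<in> K \<Longrightarrow> coercive (twist J \<gamma> T) (k \<gamma>)"
    by (auto dest!: bchoice)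
  then have pos: "\<gamma> \<in> K \<Longrightarrow> 0 < k \<gamma>" for \<gamma> by (auto simp: coercive_def)
  have "K \<subseteq> (\<Union>\<gamma>\<in>K. ball \<gamma> (k \<gamma> / 2))" using pos by force
  from compactE_image[OF K _ this] obtain C where C: "C \<subseteq> K" "finite C" "K \<subseteq> (\<Union>\<gamma>\<in>C. ball \<gamma> (k \<gamma> / 2))"
    by auto
  \<comment> \<open>The inserted 1 keeps the minimum meaningful when the finite cover is
    empty.\<close>
  define \<kappa> where "\<kappa> = Min (insert 1 ((\<lambda>\<gamma>. k \<gamma> / 2) ` C))"
  have \<kappa>: "\<kappa> > 0" using C pos by (auto simp: \<kappa>_def)
  show thesis
  proof (rule that)
    fix s assume "s \<in> K"
    then obtain \<gamma> where \<gamma>: "\<gamma> \<in> C" "s \<in> ball \<gamma> (k \<gamma> / 2)" using C by blast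
    then have "coercive (twist J s T) (k \<gamma> / 2)"
      using C k by (intro coercive_twist_near[of \<gamma>]) (auto simp: dist_real_def abs_minus_commute)
    moreover have "\<kappa> \<le> k \<gamma> / 2" unfolding \<kappa>_def using C(2) \<gamma>(1) by (intro Min_le) auto
    then have "\<kappa> * norm x \<le> k \<gamma> / 2 * norm x" for x :: 'a by (rule mult_right_mono) simp
    ultimately show "coercive (twist J s T) \<kappa>"
      unfolding coercive_def using \<kappa> order_trans by blast
  qed
qed

end

section \<open>The Fejer kernel\<close>

definition triangle :: "real \<Rightarrow> real \<Rightarrow> real \<Rightarrow> real" where
  "triangle u h s = max 0 (1 - \<bar>s - u\<bar> / h)"

text \<open>The Fourier transform of \<open>triangle 0 h\<close>, with the removable singularity at \<open>0\<close> filled in.\<close>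

definition fejer :: "real \<Rightarrow> real \<Rightarrow> real" where
  "fejer h t = (if t = 0 then h else 2 * (1 - cos (h * t)) / (h * t\<^sup>2))"

text \<open>The value is \<open>2 * pi\<close>. It is kept as a symbol because it cancels, being
  positive, from the estimates.\<close>

definition fejer_mass :: real where
  "fejer_mass = integral UNIV (fejer 1)"

lemma continuous_triangle [continuous_intros]: "h > 0 \<Longrightarrow> continuous_on S (triangle u h)"
  unfolding triangle_def by (intro continuous_intros) auto

lemma fourier_triangle:
  assumes h: "h > 0" and M: "\<bar>u\<bar> + h \<le> M"
  shows "integral {- M..M} (\<lambda>s. triangle u h s *\<^sub>R cis (s * t)) = fejer h t *\<^sub>R cis (u * t)"
proof -
  \<comment> \<open>Antiderivative of \<open>(1 + c * (s - u)) *\<^sub>R cis (s * t)\<close>, found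
    by parts; \<open>c = 1 / h\<close> and \<open>c = - 1 / h\<close> give the two sides of the
    triangle.\<close>
  define \<Phi> where "\<Phi> c s = (if t = 0 then of_real (s + c * (s - u)\<^sup>2 / 2)
      else (1 + c * (s - u)) *\<^sub>R cis (s * t) / (\<i> * of_real t) + c *\<^sub>R cis (s * t) / (of_real t)\<^sup>2)" for c s :: real
  have deriv: "(\<Phi> c has_vector_derivative (1 + c * (s - u)) *\<^sub>R cis (s * t)) (at s within S)" for c s S
  proof (cases "t = 0")
    case True
    have "((\<lambda>s. s + c * (s - u)\<^sup>2 / 2) has_real_derivative 1 + c * (s - u)) (at s within S)"
      by (auto intro!: derivative_eq_intros)
    from has_vector_derivative_of_real[OF this]
    have "((\<lambda>s. complex_of_real (s + c * (s - u)\<^sup>2 / 2)) has_vector_derivative of_real (1 + c * (s - u))) (at s within S)" .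
    then show ?thesis
      using True by (simp add: \<Phi>_def[abs_def] scaleR_conv_of_real)
  next
    case False
    have cis: "((\<lambda>s. cis (s * t)) has_vector_derivative (of_real t * \<i> * cis (s * t))) (at s within S)"
      by (auto intro!: derivative_eq_intros simp: has_vector_derivative_def scaleR_conv_of_real algebra_simps)
    have lin: "((\<lambda>s. 1 + c * (s - u)) has_vector_derivative c) (at s within S)"
      by (auto intro!: derivative_eq_intros)
    have "((\<lambda>s. (1 + c * (s - u)) *\<^sub>R cis (s * t) / (\<i> * of_real t) + c *\<^sub>R cis (s * t) / (of_real t)\<^sup>2) has_vector_derivative
       ((1 + c * (s - u)) *\<^sub>R (of_real t * \<i> * cis (s * t)) + c *\<^sub>R cis (s * t)) / (\<i> * of_real t)
         + c *\<^sub>R (of_real t * \<i> * cis (s * t)) / (of_real t)\<^sup>2) (at s within S)"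
      by (intro has_vector_derivative_add has_vector_derivative_divide
            bounded_bilinear.has_vector_derivative[OF bounded_bilinear_scaleR lin cis]
            bounded_linear.has_vector_derivative[OF bounded_linear_scaleR_right cis])
    moreover have "((1 + c * (s - u)) *\<^sub>R (of_real t * \<i> * cis (s * t)) + c *\<^sub>R cis (s * t)) / (\<i> * of_real t)
         + c *\<^sub>R (of_real t * \<i> * cis (s * t)) / (of_real t)\<^sup>2 = (1 + c * (s - u)) *\<^sub>R cis (s * t)"
      using False by (simp add: scaleR_conv_of_real field_simps power2_eq_square)
    ultimately show ?thesis using False by (simp add: \<Phi>_def[abs_def])
  qed
  have piece: "((\<lambda>s. triangle u h s *\<^sub>R cis (s * t)) has_integral (\<Phi> c b - \<Phi> c a)) {a..b}"
    if "a \<le> b" "\<And>s. s \<in> {a..b} \<Longrightarrow> triangle u h s = 1 + c * (s - u)" for a b c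
    using fundamental_theorem_of_calculus[OF that(1) deriv[of c]]
    by (rule has_integral_eq[rotated]) (simp add: that(2))
  have "((\<lambda>s. triangle u h s *\<^sub>R cis (s * t)) has_integral
      (\<Phi> (1 / h) u - \<Phi> (1 / h) (u - h)) + (\<Phi> (- 1 / h) (u + h) - \<Phi> (- 1 / h) u)) {u - h..u + h}"
  proof (rule has_integral_combine)
    show "((\<lambda>s. triangle u h s *\<^sub>R cis (s * t)) has_integral (\<Phi> (1 / h) u - \<Phi> (1 / h) (u - h))) {u - h..u}"
      using h by (intro piece) (auto simp: triangle_def field_simps)
    show "((\<lambda>s. triangle u h s *\<^sub>R cis (s * t)) has_integral (\<Phi> (- 1 / h) (u + h) - \<Phi> (- 1 / h) u)) {u..u + h}"
      using h by (intro piece) (auto simp: triangle_def field_simps)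
  qed (use h in auto)
  also have "(\<Phi> (1 / h) u - \<Phi> (1 / h) (u - h)) + (\<Phi> (- 1 / h) (u + h) - \<Phi> (- 1 / h) u) = fejer h t *\<^sub>R cis (u * t)"
  proof (cases "t = 0")
    case True
    then show ?thesis
      using h by (simp add: \<Phi>_def fejer_def field_simps power2_eq_square complex_eq_iff)
  next
    case False
    \<comment> \<open>The terms at \<open>u - h\<close>, \<open>u\<close> and \<open>u + h\<close>
      form a second difference of \<open>cis\<close>, the source of
      \<open>1 - cos (h * t)\<close>.\<close>
    have "cis ((u - h) * t) + cis ((u + h) * t) = 2 * cos (h * t) * cis (u * t)"
      by (simp add: complex_eq_iff left_diff_distrib distrib_right cos_diff cos_add sin_diff sin_add)
    then have eq: "cis ((u - h) * t) = 2 * cos (h * t) * cis (u * t) - cis ((u + h) * t)"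
      by (simp add: algebra_simps)
    show ?thesis
      using False h by (simp add: \<Phi>_def fejer_def eq scaleR_conv_of_real) (simp add: field_simps power2_eq_square)
  qed
  finally have "((\<lambda>s. triangle u h s *\<^sub>R cis (s * t)) has_integral fejer h t *\<^sub>R cis (u * t)) {- M..M}"
    by (rule has_integral_on_superset) (use h M in \<open>auto simp: triangle_def field_simps abs_if split: if_splits\<close>)
  then show ?thesis by (rule integral_unique)
qed

lemma fejer_nonneg: "h > 0 \<Longrightarrow> 0 \<le> fejer h t"
  by (simp add: fejer_def)

lemma fejer_scale: "h > 0 \<Longrightarrow> fejer h t = h * fejer 1 (h * t)"
  by (simp add: fejer_def power2_eq_square)

text \<open>The constant is 1 + 4: \<open>2 * (1 - cos t)\<close> is at most
  \<open>t\<^sup>2\<close> and at most 4, and the second bound is multiplied by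
  \<open>t\<^sup>2\<close> before adding.\<close>

lemma fejer_bound: "fejer 1 t \<le> 5 * inverse (1 + t\<^sup>2)"
proof (cases "t = 0")
  case False
  have "2 * (1 - cos t) \<le> t\<^sup>2"
  proof -
    have "\<bar>sin (t / 2)\<bar> \<le> \<bar>t / 2\<bar>" by (rule abs_sin_x_le_abs_x)
    then have "(sin (t / 2))\<^sup>2 \<le> (t / 2)\<^sup>2" by (simp only: abs_le_square_iff)
    then show ?thesis using cos_double_sin[of "t / 2"] by (simp add: power_divide)
  qed
  moreover have four: "2 * (1 - (- 1)) = (4 :: real)" by simp
  have "2 * (1 - cos t) \<le> 2 * (1 - (- 1))"
    by (intro mult_left_mono diff_left_mono cos_ge_minus_one) auto
  then have "2 * (1 - cos t) \<le> 4" by (simp only: four)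
  then have "t\<^sup>2 * (2 * (1 - cos t)) \<le> t\<^sup>2 * 4" by (rule mult_left_mono) simp
  ultimately have "2 * (1 - cos t) * (1 + t\<^sup>2) \<le> 5 * t\<^sup>2" by (simp add: algebra_simps)
  moreover have "t\<^sup>2 > 0" "1 + t\<^sup>2 > 0" using False by (auto simp: add_pos_nonneg)
  ultimately show ?thesis
    using False by (simp add: fejer_def field_simps)
qed (simp add: fejer_def)

lemma fejer_measurable [measurable]: "fejer h \<in> borel_measurable borel"
  unfolding fejer_def[abs_def] by measurable

lemma integrable_fejer_1: "integrable lborel (fejer 1)"
proof (rule Bochner_Integration.integrable_bound)
  show "integrable lborel (\<lambda>t::real. 5 * inverse (1 + t\<^sup>2))"
    using integrable_inverse_1_plus_square by (simp add: set_integrable_def)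
  show "AE t in lborel. norm (fejer 1 t) \<le> norm (5 * inverse (1 + t\<^sup>2))"
    using fejer_bound fejer_nonneg[of 1] by (auto simp: abs_of_nonneg)
qed simp

lemma integrable_fejer:
  assumes "h > 0"
  shows "integrable lborel (fejer h)" "(\<integral>t. fejer h t \<partial>lborel) = fejer_mass"
proof -
  have eq: "fejer h = (\<lambda>t. h * fejer 1 (0 + h * t))" using fejer_scale[OF assms] by auto
  show "integrable lborel (fejer h)"
    unfolding eq using assms by (intro integrable_mult_right lborel_integrable_real_affine integrable_fejer_1) auto
  show "(\<integral>t. fejer h t \<partial>lborel) = fejer_mass"
    using lborel_integral_real_affine[of h "fejer 1" 0] assms integral_lborel[OF integrable_fejer_1]
    unfolding eq fejer_mass_def by simp
qed

text \<open>On \<open>{1..2}\<close> the cosine is at most \<open>cos 1\<close> and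
  \<open>t\<^sup>2\<close> at most 4, which leaves a positive constant below the kernel.\<close>

lemma fejer_mass_pos: "fejer_mass > 0"
proof -
  have int: "fejer 1 integrable_on UNIV" using integrable_fejer_1 by (rule integrable_on_lborel)
  have sub: "fejer 1 integrable_on {1..2}" using integrable_on_subcbox[OF int, of 1 2] by simp
  have "cos (1::real) < 1" using cos_monotone_0_pi[of 0 1] pi_gt3 by simp
  then have "0 < integral {1..2} (\<lambda>t::real. (1 - cos 1) / 2 :: real)" by simp
  also have "\<dots> \<le> integral {1..2} (fejer 1)"
  proof (rule integral_le[OF _ sub])
    fix t :: real assume t: "t \<in> {1..2}"
    have "cos t \<le> cos 1" using t pi_gt3 by (intro cos_monotone_0_pi_le) auto
    moreover have "t\<^sup>2 \<le> 4" using t power_mono[of t 2 2] by simp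
    ultimately have "(1 - cos 1) * t\<^sup>2 \<le> (1 - cos t) * 4" by (intro mult_mono) auto
    moreover have "t \<noteq> 0" using t by auto
    ultimately show "(1 - cos 1) / 2 \<le> fejer 1 t" by (simp add: fejer_def field_simps)
  qed auto
  also have "\<dots> \<le> fejer_mass"
    unfolding fejer_mass_def by (intro integral_subset_le sub int) (auto simp: fejer_nonneg)
  finally show ?thesis .
qed

lemma fejer_kernel_integrable:
  assumes "h > 0"
  shows "(\<lambda>t. fejer h t *\<^sub>R cis (u * t)) absolutely_integrable_on UNIV"
proof -
  have "integrable lborel (\<lambda>t. fejer h t *\<^sub>R cis (u * t))"
  proof (rule Bochner_Integration.integrable_bound[OF integrable_fejer(1)[OF assms]])
    have "(\<lambda>t. cis (u * t)) \<in> borel_measurable borel"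
      by (intro borel_measurable_continuous_onI continuous_intros)
    then show "(\<lambda>t. fejer h t *\<^sub>R cis (u * t)) \<in> borel_measurable lborel" by simp
  qed simp
  then show ?thesis
    unfolding absolutely_integrable_on_def
    by (intro conjI integrable_on_lborel) (auto dest: integrable_norm)
qed

lemma integral_norm_fejer_kernel:
  assumes "h > 0"
  shows "integral UNIV (\<lambda>t. norm (fejer h t *\<^sub>R cis (u * t))) = fejer_mass"
  using integral_lborel[OF integrable_fejer(1)[OF assms]] integrable_fejer(2)[OF assms] fejer_nonneg[OF assms]
  by simp

abbreviation fejer_kernel :: "real \<Rightarrow> real \<Rightarrow> real \<Rightarrow> complex" where
  "fejer_kernel u h \<equiv> \<lambda>t. fejer h t *\<^sub>R cis (u * t)"

section \<open>Operators given by Fejer kernels\<close>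

context isometry_group
begin

text \<open>As \<open>fejer\<close> is nonnegative and \<open>cis\<close> unimodular, the L1 norm of
  the kernel is exactly its mass for all \<open>u\<close> and \<open>h\<close>. This exactness
  yields the contraction behind the sharp constant \<open>b - a\<close>.\<close>

lemma norm_l1act_fejer_le: "h > 0 \<Longrightarrow> norm (l1act J T (fejer_kernel u h) x) \<le> fejer_mass * norm x"
  using norm_l1act_le[OF fejer_kernel_integrable[of h u], of x] integral_norm_fejer_kernel[of h u] by simp

text \<open>An approximate identity up to the factor \<open>fejer_mass\<close>: rescaling by
  \<open>h\<close> fixes the kernel and moves the parameter into the displacement \<open>d\<close>,
  which is bounded and continuous with \<open>d 0 = 0\<close>.\<close>

lemma l1act_fejer_tendsto:
  assumes h: "\<And>n. h n > 0" and lim: "filterlim h at_top sequentially"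
  shows "(\<lambda>n. l1act J T (fejer_kernel 0 (h n)) x) \<longlonglongrightarrow> fejer_mass *\<^sub>R x"
proof -
  define d where "d t = norm (T (- t) x - x)" for t
  have d_cont: "continuous_on UNIV d" unfolding d_def by (intro continuous_intros)
  have d_meas [measurable]: "d \<in> borel_measurable borel"
    using d_cont by (rule borel_measurable_continuous_onI)
  have d_le: "0 \<le> d t" "d t \<le> 2 * norm x" for t
    using norm_triangle_ineq4[of "T (- t) x" x] by (auto simp: d_def)
  have int_lb: "integrable lborel (\<lambda>t. fejer k t * d (c * t))" if "k > 0" for k c
  proof (rule Bochner_Integration.integrable_bound)
    show "integrable lborel (\<lambda>t. 2 * norm x * fejer k t)"
      by (intro integrable_mult_right integrable_fejer that)
    show "AE t in lborel. norm (fejer k t * d (c * t)) \<le> norm (2 * norm x * fejer k t)"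
    proof (rule AE_I2)
      fix t
      have "fejer k t * d (c * t) \<le> fejer k t * (2 * norm x)"
        by (intro mult_left_mono d_le fejer_nonneg that)
      then show "norm (fejer k t * d (c * t)) \<le> norm (2 * norm x * fejer k t)"
        using d_le fejer_nonneg[OF that] by (simp add: abs_mult mult_ac)
    qed
  qed simp
  have bound: "norm (l1act J T (fejer_kernel 0 k) x - fejer_mass *\<^sub>R x) \<le> (\<integral>t. fejer 1 t * d (inverse k * t) \<partial>lborel)"
    if k: "k > 0" for k
  proof -
    have fx: "((\<lambda>t. fejer k t *\<^sub>R x) has_integral fejer_mass *\<^sub>R x) UNIV"
      using has_integral_integral_lborel[OF integrable_fejer(1)[OF k]]
      unfolding integrable_fejer(2)[OF k] by (rule has_integral_scaleR_left)
    have int: "(\<lambda>t. cmult J (fejer_kernel 0 k t) (T (- t) x)) integrable_on UNIV"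
      by (rule l1act_integrable[OF fejer_kernel_integrable[OF k]])
    have eq: "cmult J (fejer_kernel 0 k t) (T (- t) x) - fejer k t *\<^sub>R x = fejer k t *\<^sub>R (T (- t) x - x)" for t
      by (simp add: cmult.scaleR_left scaleR_diff_right)
    have "l1act J T (fejer_kernel 0 k) x - fejer_mass *\<^sub>R x = integral UNIV (\<lambda>t. fejer k t *\<^sub>R (T (- t) x - x))"
      unfolding l1act_def eq[symmetric] integral_diff[OF int has_integral_integrable[OF fx]] integral_unique[OF fx] ..
    also have "norm \<dots> \<le> integral UNIV (\<lambda>t. fejer k t * d (1 * t))"
    proof (rule integral_norm_bound_integral)
      show "(\<lambda>t. fejer k t *\<^sub>R (T (- t) x - x)) integrable_on UNIV"
        unfolding eq[symmetric] by (rule integrable_diff[OF int has_integral_integrable[OF fx]])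
      show "(\<lambda>t. fejer k t * d (1 * t)) integrable_on UNIV"
        by (rule integrable_on_lborel[OF int_lb[OF k]])
    qed (use fejer_nonneg[OF k] in \<open>simp add: d_def\<close>)
    also have "\<dots> = (\<integral>t. fejer k t * d (1 * t) \<partial>lborel)"
      by (rule integral_lborel[OF int_lb[OF k]])
    also have "\<dots> = inverse k * (\<integral>t. fejer k (inverse k * t) * d (inverse k * t) \<partial>lborel)"
      using k lborel_integral_real_affine[of "inverse k" "\<lambda>t. fejer k t * d (1 * t)" 0] by simp
    also have "\<dots> = (\<integral>t. fejer 1 t * d (inverse k * t) \<partial>lborel)"
    proof -
      have "inverse k * (fejer k (inverse k * t) * d (inverse k * t)) = fejer 1 t * d (inverse k * t)" for t
      proof -
        have "k * (inverse k * t) = t" using k by (simp add: mult.assoc[symmetric])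
        then have "fejer k (inverse k * t) = k * fejer 1 t" using fejer_scale[OF k, of "inverse k * t"] by (simp only:)
        then show ?thesis using k by (simp add: field_simps)
      qed
      then show ?thesis by (simp only: flip: integral_mult_right_zero)
    qed
    finally show ?thesis .
  qed
  have "(\<lambda>n. \<integral>t. fejer 1 t * d (inverse (h n) * t) \<partial>lborel) \<longlonglongrightarrow> integral\<^sup>L lborel (\<lambda>t::real. 0)"
  proof (rule integral_dominated_convergence[where w = "\<lambda>t. 2 * norm x * fejer 1 t"])
    show "integrable lborel (\<lambda>t. 2 * norm x * fejer 1 t)"
      by (intro integrable_mult_right integrable_fejer_1)
    have inv: "(\<lambda>n. inverse (h n)) \<longlonglongrightarrow> 0"
      using tendsto_inverse_0_at_top[OF lim] .
    show "AE t in lborel. (\<lambda>n. fejer 1 t * d (inverse (h n) * t)) \<longlonglongrightarrow> 0"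
    proof (rule AE_I2)
      fix t
      have "(\<lambda>n. inverse (h n) * t) \<longlonglongrightarrow> 0" using inv by (rule tendsto_mult_left_zero)
      moreover have "isCont d 0" using d_cont by (simp add: continuous_on_eq_continuous_at)
      ultimately have "(\<lambda>n. d (inverse (h n) * t)) \<longlonglongrightarrow> d 0" by (rule isCont_tendsto_compose[of 0 d, rotated])
      moreover have "d 0 = 0" by (simp add: d_def)
      ultimately have "(\<lambda>n. d (inverse (h n) * t)) \<longlonglongrightarrow> 0" by (simp only:)
      then show "(\<lambda>n. fejer 1 t * d (inverse (h n) * t)) \<longlonglongrightarrow> 0"
        by (rule tendsto_mult_right_zero)
    qed
    show "AE t in lborel. norm (fejer 1 t * d (inverse (h n) * t)) \<le> 2 * norm x * fejer 1 t" for n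
    proof (rule AE_I2)
      fix t
      have "fejer 1 t * d (inverse (h n) * t) \<le> fejer 1 t * (2 * norm x)"
        by (intro mult_left_mono d_le fejer_nonneg) simp
      then show "norm (fejer 1 t * d (inverse (h n) * t)) \<le> 2 * norm x * fejer 1 t"
        using d_le fejer_nonneg[of 1 t] by (simp add: abs_mult mult_ac)
    qed
  qed (measurable)
  then have "(\<lambda>n. \<integral>t. fejer 1 t * d (inverse (h n) * t) \<partial>lborel) \<longlonglongrightarrow> 0" by simp
  then have "(\<lambda>n. l1act J T (fejer_kernel 0 (h n)) x - fejer_mass *\<^sub>R x) \<longlonglongrightarrow> 0"
    by (rule Lim_null_comparison[OF always_eventually[OF allI[OF bound[OF h]]]])
  then show ?thesis by (rule LIM_zero_cancel)
qed

lemma cesaro_triangle_tendsto: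
  assumes "h > 0" "\<bar>u\<bar> + h \<le> M"
  shows "(\<lambda>n. integral {- M..M} (\<lambda>s. triangle u h s *\<^sub>R cesaro (real n) (twist J s T) x))
    \<longlonglongrightarrow> l1act J T (fejer_kernel u h) x"
  using cesaro_twist_tendsto_l1act[of M "triangle u h" x] assms fejer_kernel_integrable[of h u]
  by (simp add: fourier_triangle continuous_triangle)

text \<open>Two evaluations of one limit: the means converge to the action of the kernel, and they
  converge to 0 because the triangle is nonzero only where a single \<open>\<kappa>\<close>
  serves.\<close>

lemma l1act_fejer_eq_0:
  assumes gen: "generates T x w" and co: "\<And>s. \<bar>s - u\<bar> < h \<Longrightarrow> coercive (twist J s T) \<kappa>" and h: "h > 0"
  shows "l1act J T (fejer_kernel u h) x = 0"
proof (rule LIMSEQ_unique)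
  show "(\<lambda>n. integral {- (\<bar>u\<bar> + h)..\<bar>u\<bar> + h} (\<lambda>s. triangle u h s *\<^sub>R cesaro (real n) (twist J s T) x))
    \<longlonglongrightarrow> l1act J T (fejer_kernel u h) x"
    using h by (intro cesaro_triangle_tendsto) auto
  show "(\<lambda>n. integral {- (\<bar>u\<bar> + h)..\<bar>u\<bar> + h} (\<lambda>s. triangle u h s *\<^sub>R cesaro (real n) (twist J s T) x))
    \<longlonglongrightarrow> 0"
  proof (rule cesaro_twist_tendsto_0[OF gen])
    fix s assume "triangle u h s \<noteq> 0"
    then have "\<bar>s - u\<bar> < h" using h by (auto simp: triangle_def max_def field_simps split: if_splits)
    then show "coercive (twist J s T) \<kappa>" by (rule co)
  qed (intro continuous_intros h)
qed

end

section \<open>Boundedness of the generator\<close>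

lemma LIMSEQ_cong_ge:
  fixes f g :: "nat \<Rightarrow> 'b::topological_space"
  assumes "f \<longlonglongrightarrow> l" "\<And>m. m \<ge> N \<Longrightarrow> f m = g m"
  shows "g \<longlonglongrightarrow> l"
  using assms(1) by (rule Lim_transform_eventually) (rule eventually_sequentiallyI[of N], rule assms(2))

context isometry_group
begin

lemma generates_J: "generates T x w \<Longrightarrow> generates T (J x) (J w)"
  by (rule generates_bounded_linear) (auto simp: T_J blinfun.bounded_linear_right)

text \<open>The Fourier transforms of \<open>2 \<cdot> fejer (2n) - fejer n\<close> are trapezoids \<open>g\<close> equal to \<open>1\<close> near the spectrum. There the
  triangle coincides with \<open>(1 - \<sigma> (s - u) / (b - a)) g s\<close>, so both functions of \<open>A\<close> agree on the domain of \<open>A\<close>. Since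
  the triangle comes from a positive kernel, its operator is a contraction after division by the mass of the kernel.\<close>

lemma norm_generator_triangle_le:
  fixes a b u \<sigma> :: real
  assumes gen: "generates T x w" and "a < b" and spec: "beurling_spectrum J T UNIV \<subseteq> {a<..<b}"
    and tri: "\<And>s. s \<in> {a..b} \<Longrightarrow> triangle u (b - a) s = 1 - \<sigma> * (s - u) / (b - a)"
  shows "norm ((b - a + \<sigma> * u) *\<^sub>R J x - \<sigma> *\<^sub>R w) \<le> (b - a) * norm x"
proof -
  define h where "h = b - a"
  have h: "h > 0" using \<open>a < b\<close> by (simp add: h_def)
  define V where "V n y = 2 *\<^sub>R l1act J T (fejer_kernel 0 (2 * n)) y - l1act J T (fejer_kernel 0 n) y" for n y
  \<comment> \<open>For such \<open>n\<close> the trapezoid is 1 between \<open>a\<close> and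
    \<open>b\<close>. The action is evaluated at \<open>J x\<close> because \<open>w\<close> stands
    for \<i>Ax: real coefficients of \<open>J x\<close> and \<open>w\<close> then express real
    linear polynomials in \<open>A\<close>, up to the isometry \<open>J\<close>.\<close>
  have fixed: "l1act J T (fejer_kernel u h) (J x) = (1 + \<sigma> * u / h) *\<^sub>R V n (J x) - (\<sigma> / h) *\<^sub>R V n w"
    if n: "n > \<bar>a\<bar> + \<bar>b\<bar>" for n
  proof -
    have n0: "n > 0" using n by linarith
    define M where "M = max (2 * n) (\<bar>u\<bar> + h)"
    define g where "g s = 2 * triangle 0 (2 * n) s - triangle 0 n s" for s
    define C where "C m s y = cesaro (real m) (twist J s T) y" for m s y
    define I where "I k y m = integral {- M..M} (\<lambda>s. k s *\<^sub>R C m s y)" for k y m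
    \<comment> \<open>The triangle minus its linear formula cut off by \<open>g\<close>. It is 0 on
      the open interval around the spectrum, hence without effect in the limit.\<close>
    define q where "q s = triangle u h s - (1 + \<sigma> * u / h) * g s + (\<sigma> / h) * (g s * s)" for s
    have g_cont: "continuous_on S g" for S
      unfolding g_def using n0 by (intro continuous_intros) auto
    have q_cont: "continuous_on S q" for S
      unfolding q_def using h by (intro continuous_intros g_cont)
    have int: "(\<lambda>s. k s *\<^sub>R C m s y) integrable_on {- M..M}" if "continuous_on {- M..M} k" "m > 0" for k m y
      unfolding C_def cesaro_def using that by (intro integral_twist_swap continuous_intros) auto
    have I_tri: "(\<lambda>m. I (triangle u h) y m) \<longlonglongrightarrow> l1act J T (fejer_kernel u h) y" for y
      unfolding I_def C_def using h by (intro cesaro_triangle_tendsto) (auto simp: M_def)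
    have I_g: "(\<lambda>m. I g y m) \<longlonglongrightarrow> V n y" for y
    proof -
      have "(\<lambda>m. 2 *\<^sub>R I (triangle 0 (2 * n)) y m - I (triangle 0 n) y m) \<longlonglongrightarrow> V n y"
        unfolding V_def I_def C_def using n0
        by (intro tendsto_diff tendsto_scaleR tendsto_const cesaro_triangle_tendsto) (auto simp: M_def)
      moreover have "2 *\<^sub>R I (triangle 0 (2 * n)) y m - I (triangle 0 n) y m = I g y m" if "m \<ge> 1" for m
      proof -
        have i1: "(\<lambda>s. 2 *\<^sub>R (triangle 0 (2 * n) s *\<^sub>R C m s y)) integrable_on {- M..M}"
          and i2: "(\<lambda>s. triangle 0 n s *\<^sub>R C m s y) integrable_on {- M..M}"
          using n0 that by (auto intro!: integrable_cmul int continuous_intros)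
        have "(\<lambda>s. g s *\<^sub>R C m s y) = (\<lambda>s. 2 *\<^sub>R (triangle 0 (2 * n) s *\<^sub>R C m s y) - triangle 0 n s *\<^sub>R C m s y)"
          by (simp add: fun_eq_iff g_def scaleR_diff_left)
        then show ?thesis
          unfolding I_def by (simp only: integral_diff[OF i1 i2] integral_cmul)
      qed
      ultimately show ?thesis
        by (rule LIMSEQ_cong_ge)
    qed
    \<comment> \<open>The means of \<open>s *\<^sub>R J x - w\<close> vanish in the limit, which
      trades the factor \<open>s\<close> in the weight for the vector \<open>w\<close>.\<close>
    have I_gs: "(\<lambda>m. I (\<lambda>s. g s * s) (J x) m) \<longlonglongrightarrow> V n w"
    proof -
      have F: "(\<lambda>t. integral {- M..M} (\<lambda>s. g s *\<^sub>R cis (s * t))) =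
          (\<lambda>t. 2 *\<^sub>R fejer_kernel 0 (2 * n) t - fejer_kernel 0 n t)"
      proof
        fix t
        have i1: "(\<lambda>s. 2 *\<^sub>R (triangle 0 (2 * n) s *\<^sub>R cis (s * t))) integrable_on {- M..M}"
          and i2: "(\<lambda>s. triangle 0 n s *\<^sub>R cis (s * t)) integrable_on {- M..M}"
          using n0 by (auto intro!: integrable_cmul integrable_continuous_real continuous_intros)
        have "(\<lambda>s. g s *\<^sub>R cis (s * t)) = (\<lambda>s. 2 *\<^sub>R (triangle 0 (2 * n) s *\<^sub>R cis (s * t)) - triangle 0 n s *\<^sub>R cis (s * t))"
          by (simp add: fun_eq_iff g_def scaleR_diff_left)
        moreover have "integral {- M..M} (\<lambda>s. triangle 0 (2 * n) s *\<^sub>R cis (s * t)) = fejer_kernel 0 (2 * n) t"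
          by (rule fourier_triangle) (use n0 in \<open>auto simp: M_def\<close>)
        moreover have "integral {- M..M} (\<lambda>s. triangle 0 n s *\<^sub>R cis (s * t)) = fejer_kernel 0 n t"
          by (rule fourier_triangle) (use n0 in \<open>auto simp: M_def\<close>)
        ultimately show "integral {- M..M} (\<lambda>s. g s *\<^sub>R cis (s * t)) = 2 *\<^sub>R fejer_kernel 0 (2 * n) t - fejer_kernel 0 n t"
          by (simp only: integral_diff[OF i1 i2] integral_cmul)
      qed
      have "(\<lambda>t. 2 *\<^sub>R fejer_kernel 0 (2 * n) t - fejer_kernel 0 n t) absolutely_integrable_on UNIV"
        using n0 by (intro set_integral_diff absolutely_integrable_scaleR_left fejer_kernel_integrable) auto
      then have "(\<lambda>m. integral {- M..M} (\<lambda>s. g s *\<^sub>R C m s (s *\<^sub>R J x - w))) \<longlonglongrightarrow> 0"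
        unfolding C_def F[symmetric] by (intro cesaro_twist_generates_tendsto_0 gen g_cont)
      from tendsto_add[OF this I_g[of w]]
      have "(\<lambda>m. integral {- M..M} (\<lambda>s. g s *\<^sub>R C m s (s *\<^sub>R J x - w)) + I g w m) \<longlonglongrightarrow> V n w" by simp
      moreover have "integral {- M..M} (\<lambda>s. g s *\<^sub>R C m s (s *\<^sub>R J x - w)) + I g w m = I (\<lambda>s. g s * s) (J x) m" if "m \<ge> 1" for m
      proof -
        have C_lin: "C m s (s *\<^sub>R J x - w) = s *\<^sub>R C m s (J x) - C m s w" for s
        proof -
          interpret U: isometry_group J "twist J s T" by (rule isometry_group_twist)
          have "bounded_linear (C m s)"
            unfolding C_def cesaro_def using that by (intro U.bounded_linear_weighted continuous_intros) auto
          then interpret C: bounded_linear "C m s" .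
          show ?thesis by (simp add: C.diff C.scaleR)
        qed
        have i1: "(\<lambda>s. (g s * s) *\<^sub>R C m s (J x)) integrable_on {- M..M}"
          and i2: "(\<lambda>s. g s *\<^sub>R C m s w) integrable_on {- M..M}"
          using that by (auto intro!: int continuous_intros g_cont)
        have "(\<lambda>s. g s *\<^sub>R C m s (s *\<^sub>R J x - w)) = (\<lambda>s. (g s * s) *\<^sub>R C m s (J x) - g s *\<^sub>R C m s w)"
          by (simp add: fun_eq_iff C_lin scaleR_diff_right)
        then show ?thesis unfolding I_def by (simp add: integral_diff[OF i1 i2])
      qed
      ultimately show ?thesis
        by (rule LIMSEQ_cong_ge)
    qed
    \<comment> \<open>Removing an open interval leaves a compact set disjoint from the spectrum, on
      which one \<open>\<kappa>\<close> serves for all \<open>s\<close>.\<close>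
    have "compact ({- M..M} - {a<..<b})" by (intro compact_diff) auto
    moreover have "({- M..M} - {a<..<b}) \<inter> beurling_spectrum J T UNIV = {}" using spec by auto
    ultimately obtain \<kappa> where \<kappa>: "\<And>s. s \<in> {- M..M} - {a<..<b} \<Longrightarrow> coercive (twist J s T) \<kappa>"
      using coercive_compact by blast
    have I_q: "(\<lambda>m. I q (J x) m) \<longlonglongrightarrow> 0"
      unfolding I_def C_def
    proof (rule cesaro_twist_tendsto_0[OF generates_J[OF gen] q_cont])
      fix s assume s: "s \<in> {- M..M}" "q s \<noteq> 0"
      have "s \<notin> {a<..<b}"
      proof
        assume ab: "s \<in> {a<..<b}"
        then have "\<bar>s\<bar> \<le> n" using n by auto
        then have "g s = 1" using n0 by (auto simp: g_def triangle_def max_def field_simps)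
        moreover have "triangle u h s = 1 - \<sigma> * (s - u) / h" using tri[of s] ab by (simp add: h_def)
        ultimately have "q s = 0" using h by (simp add: q_def field_simps)
        then show False using s by simp
      qed
      then show "coercive (twist J s T) \<kappa>" using s by (intro \<kappa>) simp
    qed
    have "(\<lambda>m. I (triangle u h) (J x) m - (1 + \<sigma> * u / h) *\<^sub>R I g (J x) m + (\<sigma> / h) *\<^sub>R I (\<lambda>s. g s * s) (J x) m)
      \<longlonglongrightarrow> l1act J T (fejer_kernel u h) (J x) - (1 + \<sigma> * u / h) *\<^sub>R V n (J x) + (\<sigma> / h) *\<^sub>R V n w"
      by (intro tendsto_intros I_tri I_g I_gs)
    moreover have "I (triangle u h) (J x) m - (1 + \<sigma> * u / h) *\<^sub>R I g (J x) m + (\<sigma> / h) *\<^sub>R I (\<lambda>s. g s * s) (J x) m = I q (J x) m"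
      if "m \<ge> 1" for m
    proof -
      have i1: "(\<lambda>s. triangle u h s *\<^sub>R C m s (J x)) integrable_on {- M..M}"
        and i2: "(\<lambda>s. (1 + \<sigma> * u / h) *\<^sub>R (g s *\<^sub>R C m s (J x))) integrable_on {- M..M}"
        and i3: "(\<lambda>s. (\<sigma> / h) *\<^sub>R ((g s * s) *\<^sub>R C m s (J x))) integrable_on {- M..M}"
        using that h by (auto intro!: integrable_cmul int continuous_intros g_cont)
      have "(\<lambda>s. q s *\<^sub>R C m s (J x)) = (\<lambda>s. triangle u h s *\<^sub>R C m s (J x) -
        (1 + \<sigma> * u / h) *\<^sub>R (g s *\<^sub>R C m s (J x)) + (\<sigma> / h) *\<^sub>R ((g s * s) *\<^sub>R C m s (J x)))"
        by (simp add: fun_eq_iff q_def scaleR_diff_left scaleR_add_left)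
      then show ?thesis
        unfolding I_def by (simp only: integral_diff[OF i1 i2] integral_add[OF integrable_diff[OF i1 i2] i3] integral_cmul)
    qed
    ultimately have "(\<lambda>m. I q (J x) m) \<longlonglongrightarrow> l1act J T (fejer_kernel u h) (J x) - (1 + \<sigma> * u / h) *\<^sub>R V n (J x) + (\<sigma> / h) *\<^sub>R V n w"
      by (rule LIMSEQ_cong_ge)
    from LIMSEQ_unique[OF this I_q] show ?thesis by (simp add: algebra_simps)
  qed
  \<comment> \<open>The masses subtract as 2 - 1, so the trapezoid kernels again form an approximate
    identity.\<close>
  have V_lim: "(\<lambda>n. V (real (Suc n)) y) \<longlonglongrightarrow> fejer_mass *\<^sub>R y" for y
  proof -
    have "(\<lambda>n. V (real (Suc n)) y) \<longlonglongrightarrow> 2 *\<^sub>R (fejer_mass *\<^sub>R y) - fejer_mass *\<^sub>R y"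
      unfolding V_def
    proof (intro tendsto_diff tendsto_scaleR tendsto_const l1act_fejer_tendsto)
      show *: "filterlim (\<lambda>n. real (Suc n)) at_top sequentially"
        using filterlim_compose[OF filterlim_real_sequentially filterlim_Suc] .
      show "filterlim (\<lambda>n. 2 * real (Suc n)) at_top sequentially"
        by (rule filterlim_tendsto_pos_mult_at_top[OF tendsto_const _ *]) simp
    qed auto
    then show ?thesis by (simp only: scaleR_2 add_diff_cancel_left')
  qed
  \<comment> \<open>The left side of \<open>fixed\<close> does not depend on \<open>n\<close>;
    letting \<open>n\<close> grow removes the trapezoid and leaves \<open>z\<close>.\<close>
  define z where "z = (1 + \<sigma> * u / h) *\<^sub>R J x - (\<sigma> / h) *\<^sub>R w"
  have "(\<lambda>n. (1 + \<sigma> * u / h) *\<^sub>R V (real (Suc n)) (J x) - (\<sigma> / h) *\<^sub>R V (real (Suc n)) w) \<longlonglongrightarrow>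
    (1 + \<sigma> * u / h) *\<^sub>R (fejer_mass *\<^sub>R J x) - (\<sigma> / h) *\<^sub>R (fejer_mass *\<^sub>R w)"
    by (intro tendsto_diff tendsto_scaleR tendsto_const V_lim)
  moreover have "(1 + \<sigma> * u / h) *\<^sub>R V (real (Suc n)) (J x) - (\<sigma> / h) *\<^sub>R V (real (Suc n)) w = l1act J T (fejer_kernel u h) (J x)"
    if "n \<ge> nat \<lceil>\<bar>a\<bar> + \<bar>b\<bar>\<rceil>" for n
    by (rule fixed[symmetric]) (use that in linarith)
  ultimately have "(\<lambda>n. l1act J T (fejer_kernel u h) (J x)) \<longlonglongrightarrow>
    (1 + \<sigma> * u / h) *\<^sub>R (fejer_mass *\<^sub>R J x) - (\<sigma> / h) *\<^sub>R (fejer_mass *\<^sub>R w)"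
    by (rule LIMSEQ_cong_ge)
  then have "l1act J T (fejer_kernel u h) (J x) = fejer_mass *\<^sub>R z"
    using LIMSEQ_unique[OF tendsto_const] by (fastforce simp: z_def scaleR_diff_right mult.commute)
  then have "fejer_mass * norm z \<le> fejer_mass * norm x"
    using norm_l1act_fejer_le[OF h, of u "J x"] fejer_mass_pos by (simp add: norm_J[OF cs])
  then have "norm z \<le> norm x" using fejer_mass_pos by simp
  then have "norm (h *\<^sub>R z) \<le> h * norm x" using h by simp
  moreover have "h *\<^sub>R z = (b - a + \<sigma> * u) *\<^sub>R J x - \<sigma> *\<^sub>R w"
    using h by (simp add: z_def scaleR_diff_right distrib_left h_def)
  ultimately show ?thesis by (simp only: h_def)
qed

text \<open>The apex is put at either end: \<open>u = a\<close>, \<open>\<sigma> = 1\<close> makes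
  the coefficient \<open>b - a + \<sigma> * u\<close> equal to \<open>b\<close>, while
  \<open>u = b\<close>, \<open>\<sigma> = - 1\<close> makes it \<open>- a\<close>.\<close>

lemma generator_bounds:
  assumes gen: "generates T x w" and "a < b" and spec: "beurling_spectrum J T UNIV \<subseteq> {a<..<b}"
  shows "norm (b *\<^sub>R J x - w) \<le> (b - a) * norm x" "norm (w - a *\<^sub>R J x) \<le> (b - a) * norm x"
proof -
  show "norm (b *\<^sub>R J x - w) \<le> (b - a) * norm x"
    using norm_generator_triangle_le[OF gen \<open>a < b\<close> spec, of a 1] \<open>a < b\<close>
    by (simp add: triangle_def max_def field_simps)
  show "norm (w - a *\<^sub>R J x) \<le> (b - a) * norm x"
    using norm_generator_triangle_le[OF gen \<open>a < b\<close> spec, of b "-1"] \<open>a < b\<close>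
    by (simp add: triangle_def max_def field_simps)
qed

end

section \<open>The generator is closed and densely defined, hence everywhere defined once
  bounded\<close>

lemma has_vector_derivative_quotient:
  assumes "(f has_vector_derivative w) (at a within S)"
  shows "((\<lambda>y. (f y - f a) /\<^sub>R (y - a)) \<longlongrightarrow> w) (at a within S)"
proof -
  have "((\<lambda>y. norm (f y - f a - (y - a) *\<^sub>R w) / norm (y - a)) \<longlongrightarrow> 0) (at a within S)"
    using assms by (simp add: has_vector_derivative_def has_derivative_iff_norm)
  moreover have "\<forall>\<^sub>F y in at a within S. norm (f y - f a - (y - a) *\<^sub>R w) / norm (y - a) = norm ((f y - f a) /\<^sub>R (y - a) - w)"
    unfolding eventually_at_filter
  proof (intro always_eventually allI impI)
    fix y assume "y \<noteq> a"
    then have "(f y - f a) /\<^sub>R (y - a) - w = inverse (y - a) *\<^sub>R (f y - f a - (y - a) *\<^sub>R w)"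
      by (simp add: scaleR_diff_right)
    then show "norm (f y - f a - (y - a) *\<^sub>R w) / norm (y - a) = norm ((f y - f a) /\<^sub>R (y - a) - w)"
      by (simp add: divide_inverse)
  qed
  ultimately have "((\<lambda>y. norm ((f y - f a) /\<^sub>R (y - a) - w)) \<longlongrightarrow> 0) (at a within S)"
    by (rule Lim_transform_eventually)
  then show ?thesis by (rule LIM_zero_cancel[OF tendsto_norm_zero_cancel])
qed

context isometry_group
begin

lemma generates_add: "generates T x w \<Longrightarrow> generates T y v \<Longrightarrow> generates T (x + y) (w + v)"
  unfolding generates_def blinfun.bilinear_simps by (rule has_vector_derivative_add)

lemma generates_scaleR: "generates T x w \<Longrightarrow> generates T (r *\<^sub>R x) (r *\<^sub>R w)"
  unfolding generates_def blinfun.bilinear_simps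
  by (rule bounded_linear.has_vector_derivative[OF bounded_linear_scaleR_right])

lemma generates_diff: "generates T x w \<Longrightarrow> generates T y v \<Longrightarrow> generates T (x - y) (w - v)"
  unfolding generates_def blinfun.bilinear_simps by (rule has_vector_derivative_diff)

lemma generates_unique: "generates T x w \<Longrightarrow> generates T x v \<Longrightarrow> w = v"
  unfolding generates_def by (rule vector_derivative_unique_at)

text \<open>The orbits have derivatives \<open>T t (w n)\<close>, which converge uniformly in
  \<open>t\<close> since each \<open>T t\<close> is isometric; the limit can thus be differentiated
  term by term.\<close>

lemma generates_closed:
  assumes gen: "\<And>n. generates T (x n) (w n)" and x: "x \<longlonglongrightarrow> x'" and w: "w \<longlonglongrightarrow> w'"
  shows "generates T x' w'"
proof -
  have "\<exists>g. \<forall>t\<in>UNIV. (\<lambda>n. T t (x n)) \<longlonglongrightarrow> g t \<and> (g has_derivative (\<lambda>h. h *\<^sub>R T t w')) (at t within UNIV)"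
  proof (rule has_derivative_sequence[of UNIV "\<lambda>n t. T t (x n)" "\<lambda>n t h. h *\<^sub>R T t (w n)" "\<lambda>t h. h *\<^sub>R T t w'" 0 x'])
    show "((\<lambda>t. T t (x n)) has_derivative (\<lambda>h. h *\<^sub>R T t (w n))) (at t within UNIV)" for n t
      using generates_deriv[OF gen] by (simp add: has_vector_derivative_def)
    fix e :: real assume "e > 0"
    then have "\<forall>\<^sub>F n in sequentially. dist (w n) w' < e" using w by (simp add: tendsto_iff)
    then show "\<forall>\<^sub>F n in sequentially. \<forall>t\<in>UNIV. \<forall>h. norm (h *\<^sub>R T t (w n) - h *\<^sub>R T t w') \<le> e * norm h"
    proof eventually_elim
      case (elim n)
      show ?case
      proof (intro ballI allI)
        fix t h :: real
        have "h *\<^sub>R T t (w n) - h *\<^sub>R T t w' = h *\<^sub>R T t (w n - w')"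
          by (simp add: scaleR_diff_right blinfun.diff_right)
        then have "norm (h *\<^sub>R T t (w n) - h *\<^sub>R T t w') = norm (w n - w') * norm h" by simp
        also have "\<dots> \<le> e * norm h"
          using elim by (intro mult_right_mono) (auto simp: dist_norm)
        finally show "norm (h *\<^sub>R T t (w n) - h *\<^sub>R T t w') \<le> e * norm h" .
      qed
    qed
  next
    show "(\<lambda>n. T 0 (x n)) \<longlonglongrightarrow> x'" using x by simp
  qed simp_all
  then obtain g where g: "\<And>t. (\<lambda>n. T t (x n)) \<longlonglongrightarrow> g t" "\<And>t. (g has_derivative (\<lambda>h. h *\<^sub>R T t w')) (at t)"
    by auto
  have "g = (\<lambda>t. T t x')"
  proof
    show "g t = T t x'" for t
      by (rule LIMSEQ_unique[OF g(1)]) (intro blinfun.tendsto tendsto_const x)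
  qed
  then show ?thesis using g(2)[of 0] by (simp add: generates_def has_vector_derivative_def)
qed

lemma generates_orbit_integral:
  assumes "h > 0"
  shows "generates T (integral {0..h} (\<lambda>t. T t x)) (T h x - x)"
proof -
  \<comment> \<open>The lower limit -1 leaves room on both sides of 0, so that the derivative at 0
    is two-sided.\<close>
  define \<Phi> where "\<Phi> u = integral {- 1..u} (\<lambda>t. T t x)" for u
  have int: "(\<lambda>t. T t x) integrable_on {a..b}" for a b
    by (intro integrable_continuous_real continuous_intros)
  have \<Phi>: "(\<Phi> has_vector_derivative T u x) (at u)" if "- 1 < u" for u
  proof -
    have "(\<Phi> has_vector_derivative T u x) (at u within {- 1..u + 1})"
      unfolding \<Phi>_def using that by (intro integral_has_vector_derivative continuous_intros) auto
    then show ?thesis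
      using that by (simp add: at_within_Icc_at)
  qed
  have shift: "T u (integral {0..h} (\<lambda>t. T t x)) = \<Phi> (u + h) - \<Phi> u" if "- 1 < u" for u
  proof -
    have "T u (integral {0..h} (\<lambda>t. T t x)) = integral {0..h} (\<lambda>t. T (t + u) x)"
      by (subst integral_blinfun_apply[OF int, symmetric]) (simp only: T_add[symmetric] add.commute[of u])
    also have "\<dots> = integral {0 + u..h + u} (\<lambda>t. T t x)"
      using integral_shift_Icc_real[of 0 h "\<lambda>t. T t x" u] by (simp add: o_def add.commute)
    also have "\<dots> = \<Phi> (u + h) - \<Phi> u"
    proof -
      have "\<Phi> u + integral {u..u + h} (\<lambda>t. T t x) = \<Phi> (u + h)"
        unfolding \<Phi>_def using that \<open>h > 0\<close> by (intro Henstock_Kurzweil_Integration.integral_combine int) auto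
      then show ?thesis by (simp add: algebra_simps)
    qed
    finally show ?thesis .
  qed
  have "((\<lambda>u. u + h) has_vector_derivative 1) (at 0)" by (auto intro!: derivative_eq_intros)
  moreover have "(\<Phi> has_vector_derivative T h x) (at (0 + h))" using \<Phi>[of h] \<open>h > 0\<close> by simp
  ultimately have "((\<lambda>u. \<Phi> (u + h)) has_vector_derivative T h x) (at 0)"
    using vector_diff_chain_at[of "\<lambda>u. u + h" 1 0 \<Phi> "T h x"] by (simp add: o_def)
  from has_vector_derivative_diff[OF this \<Phi>[of 0]]
  have "((\<lambda>u. \<Phi> (u + h) - \<Phi> u) has_vector_derivative T h x - x) (at 0)" by simp
  then have "((\<lambda>u. T u (integral {0..h} (\<lambda>t. T t x))) has_vector_derivative T h x - x) (at 0)"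
    by (rule has_vector_derivative_transform_within_open[of _ _ _ "{- 1<..}"]) (auto simp: shift)
  then show ?thesis by (simp add: generates_def)
qed

text \<open>Averages of the orbit over shrinking intervals starting at 0 lie in the domain and
  converge to \<open>x\<close>.\<close>

lemma generates_dense:
  "\<exists>y w. (\<forall>n. generates T (y n) (w n)) \<and> y \<longlonglongrightarrow> x"
proof -
  define y where "y n = real (Suc n) *\<^sub>R integral {0..inverse (real (Suc n))} (\<lambda>t. T t x)" for n
  have int: "continuous_on {0..1} (\<lambda>t. T t x)" by (intro continuous_intros)
  have "((\<lambda>u. integral {0..u} (\<lambda>t. T t x)) has_vector_derivative T 0 x) (at 0 within {0..1})"
    by (rule integral_has_vector_derivative[OF int]) simp
  from has_vector_derivative_quotient[OF this]
  have lim: "((\<lambda>u. (integral {0..u} (\<lambda>t. T t x) - integral {0..0} (\<lambda>t. T t x)) /\<^sub>R (u - 0)) \<longlongrightarrow> x) (at 0 within {0..1})"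
    by simp
  have "filterlim (\<lambda>n. inverse (real (Suc n))) (at 0 within {0..1}) sequentially"
    unfolding filterlim_at
    by (intro conjI LIMSEQ_inverse_real_of_nat always_eventually allI) (auto simp: field_simps)
  from filterlim_compose[OF lim this] have "y \<longlonglongrightarrow> x"
    by (simp add: y_def[abs_def])
  moreover have gen: "generates T (y n) (real (Suc n) *\<^sub>R (T (inverse (real (Suc n))) x - x))" for n
    unfolding y_def by (intro generates_scaleR generates_orbit_integral) simp
  ultimately show ?thesis
    by (intro exI[of _ y] exI[of _ "\<lambda>n. real (Suc n) *\<^sub>R (T (inverse (real (Suc n))) x - x)"] conjI allI)
qed

text \<open>The bound makes images of a convergent sequence Cauchy, and closedness identifies their
  limit.\<close>

lemma generator_everywhere:
  assumes C: "\<And>x w. generates T x w \<Longrightarrow> norm w \<le> C * norm x"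
  shows "\<exists>w. generates T x w"
proof -
  obtain y w where gen: "\<And>n. generates T (y n) (w n)" and y: "y \<longlonglongrightarrow> x"
    using generates_dense[of x] by blast
  have bound: "norm (w m - w n) \<le> \<bar>C\<bar> * norm (y m - y n)" for m n
  proof -
    have "norm (w m - w n) \<le> C * norm (y m - y n)" by (rule C[OF generates_diff[OF gen gen]])
    also have "\<dots> \<le> \<bar>C\<bar> * norm (y m - y n)" by (intro mult_right_mono) auto
    finally show ?thesis .
  qed
  have "Cauchy w"
  proof (rule CauchyI)
    fix e :: real assume "e > 0"
    then have "e / (\<bar>C\<bar> + 1) > 0" by simp
    then obtain N where N: "\<And>m n. m \<ge> N \<Longrightarrow> n \<ge> N \<Longrightarrow> norm (y m - y n) < e / (\<bar>C\<bar> + 1)"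
      using CauchyD[OF LIMSEQ_imp_Cauchy[OF y]] by blast
    have "norm (w m - w n) < e" if "m \<ge> N" "n \<ge> N" for m n
    proof -
      have "norm (w m - w n) \<le> \<bar>C\<bar> * (e / (\<bar>C\<bar> + 1))"
        using bound[of m n] mult_left_mono[OF less_imp_le[OF N[OF that]], of "\<bar>C\<bar>"] by simp
      also have "\<dots> < e" using \<open>e > 0\<close> by (simp add: field_simps)
      finally show ?thesis .
    qed
    then show "\<exists>N. \<forall>m\<ge>N. \<forall>n\<ge>N. norm (w m - w n) < e" by blast
  qed
  then obtain w' where "w \<longlonglongrightarrow> w'" using Cauchy_convergent convergent_def by blast
  then show ?thesis using generates_closed[OF gen y] by blast
qed

lemma bounded_generator:
  assumes C: "\<And>x w. generates T x w \<Longrightarrow> norm w \<le> C * norm x"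
  obtains A where "clin J A" "\<And>x. generates T x (J (A x))"
proof -
  \<comment> \<open>\<open>W\<close> plays the role of \<i>A, so \<open>A\<close> is recovered as
    \<open>- J\<close> after \<open>W\<close>.\<close>
  define W where "W x = (SOME w. generates T x w)" for x
  have W: "generates T x (W x)" for x
    unfolding W_def using generator_everywhere[OF C] by (rule someI_ex)
  have W_eq: "generates T x w \<Longrightarrow> W x = w" for x w using generates_unique[OF W] .
  have lin: "bounded_linear (\<lambda>x. - J (W x))"
  proof (rule bounded_linear_intro)
    show "- J (W (x + y)) = - J (W x) + - J (W y)" for x y
      by (simp add: W_eq[OF generates_add[OF W W]] blinfun.bilinear_simps)
    show "- J (W (r *\<^sub>R x)) = r *\<^sub>R - J (W x)" for r x
      by (simp add: W_eq[OF generates_scaleR[OF W]] blinfun.bilinear_simps)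
    show "norm (- J (W x)) \<le> norm x * C" for x
      using C[OF W] by (simp add: norm_J[OF cs] mult.commute)
  qed
  define A where "A = Blinfun (\<lambda>x. - J (W x))"
  have A: "A x = - J (W x)" for x by (simp add: A_def bounded_linear_Blinfun_apply[OF lin])
  show thesis
  proof
    show "clin J A"
      unfolding clin_def by (intro blinfun_eqI) (simp add: A W_eq[OF generates_J[OF W]] blinfun.bilinear_simps)
    show "generates T x (J (A x))" for x
      using W[of x] by (simp add: A blinfun.bilinear_simps J_J[OF cs])
  qed
qed

end

section \<open>The operator exponential\<close>

lemma opow_0 [simp]: "opow B 0 = id_blinfun" and opow_Suc: "opow B (Suc n) = B o\<^sub>L opow B n"
  by (simp_all add: opow_def)

lemma opow_scaleR: "opow (r *\<^sub>R B) n = r ^ n *\<^sub>R opow B n"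
  by (induction n) (simp_all add: opow_Suc blinfun_eqI blinfun.bilinear_simps mult.commute)

lemma opow_commute:
  assumes "C o\<^sub>L B = B o\<^sub>L C"
  shows "C o\<^sub>L opow B n = opow B n o\<^sub>L C"
proof (induction n)
  case (Suc n)
  have "C (B x) = B (C x)" "C (opow B n x) = opow B n (C x)" for x
    using assms Suc by (metis blinfun_apply_blinfun_compose)+
  then show ?case by (intro blinfun_eqI) (simp add: opow_Suc)
qed (simp add: blinfun_eqI)

lemma norm_opow_le: "norm (opow B n) \<le> norm B ^ n"
proof (induction n)
  case 0
  show ?case by (simp add: norm_blinfun_id_le)
next
  case (Suc n)
  have "norm (B o\<^sub>L opow B n) \<le> norm B * norm (opow B n)" by (rule norm_blinfun_compose)
  also have "\<dots> \<le> norm B * norm B ^ n" using Suc by (intro mult_left_mono) auto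
  finally show ?case by (simp add: opow_Suc)
qed

lemma norm_opexp_term_le: "norm ((1 / fact n) *\<^sub>R opow B n) \<le> norm B ^ n /\<^sub>R fact n"
  using norm_opow_le[of B n] by (simp add: divide_inverse mult_left_mono mult.commute)

lemma opexp_sums: "(\<lambda>n. (1 / fact n) *\<^sub>R opow B n) sums opexp (B :: 'a::banach \<Rightarrow>\<^sub>L 'a)"
  unfolding opexp_def
  by (intro summable_sums summable_comparison_test'[OF summable_exp_generic[of "norm B"], of 0] norm_opexp_term_le)

lemma norm_opexp_le: "norm (opexp (B :: 'a::banach \<Rightarrow>\<^sub>L 'a)) \<le> exp (norm B)"
  unfolding opexp_def exp_def
  by (rule norm_suminf_le[OF norm_opexp_term_le summable_exp_generic])

lemma opexp_0 [simp]: "opexp (0 :: 'a::banach \<Rightarrow>\<^sub>L 'a) = id_blinfun"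
proof -
  have "opow (0 :: 'a \<Rightarrow>\<^sub>L 'a) n = 0" if "n \<noteq> 0" for n
    using that by (cases n) (auto simp: opow_Suc blinfun_eqI)
  then have "opexp (0 :: 'a \<Rightarrow>\<^sub>L 'a) = (\<Sum>n\<in>{0}. (1 / fact n) *\<^sub>R opow 0 n)"
    unfolding opexp_def by (intro suminf_finite) auto
  then show ?thesis by simp
qed

lemma opexp_commute:
  fixes B :: "'a::banach \<Rightarrow>\<^sub>L 'a"
  assumes "C o\<^sub>L B = B o\<^sub>L C"
  shows "C o\<^sub>L opexp B = opexp B o\<^sub>L C"
proof -
  have "(\<lambda>n. C o\<^sub>L ((1 / fact n) *\<^sub>R opow B n)) sums (C o\<^sub>L opexp B)"
    by (rule bounded_linear.sums[OF bounded_bilinear.bounded_linear_right[OF bounded_bilinear_blinfun_compose] opexp_sums])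
  moreover have "(\<lambda>n. ((1 / fact n) *\<^sub>R opow B n) o\<^sub>L C) sums (opexp B o\<^sub>L C)"
    by (rule bounded_linear.sums[OF bounded_bilinear.bounded_linear_left[OF bounded_bilinear_blinfun_compose] opexp_sums])
  moreover have "C o\<^sub>L ((1 / fact n) *\<^sub>R opow B n) = ((1 / fact n) *\<^sub>R opow B n) o\<^sub>L C" for n
    using opow_commute[OF assms, of n]
    by (simp add: bounded_bilinear.scaleR_right[OF bounded_bilinear_blinfun_compose]
        bounded_bilinear.scaleR_left[OF bounded_bilinear_blinfun_compose])
  ultimately show ?thesis using sums_unique2 by fastforce
qed

text \<open>Operators on a possibly trivial space do not form a unital normed algebra in the sense of the type classes
  (the identity has norm 0 there), so the library exponential does not apply.\<close>

lemma opexp_has_vector_derivative: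
  fixes B :: "'a::banach \<Rightarrow>\<^sub>L 'a"
  shows "((\<lambda>t. opexp (t *\<^sub>R B)) has_vector_derivative B o\<^sub>L opexp (t *\<^sub>R B)) (at t within S)"
proof -
  interpret comp: bounded_bilinear "blinfun_compose :: ('a \<Rightarrow>\<^sub>L 'a) \<Rightarrow> _ \<Rightarrow> _"
    by (rule bounded_bilinear_blinfun_compose)
  \<comment> \<open>The series converges uniformly on bounded intervals; this one has
    \<open>t\<close> in its interior.\<close>
  define R where "R = \<bar>t\<bar> + 1"
  have tR: "- R < t" "t < R" by (auto simp: R_def abs_if)
  define f where "f n t = (t ^ n / fact n) *\<^sub>R opow B n" for n t
  define f' where "f' n t h = h *\<^sub>R ((real n * t ^ (n - 1) / fact n) *\<^sub>R opow B n)" for n t h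
  have f_eq: "(1 / fact n) *\<^sub>R opow (t *\<^sub>R B) n = f n t" for n t
    by (simp add: f_def opow_scaleR)
  have sums: "(\<lambda>n. f n t) sums opexp (t *\<^sub>R B)" for t
    using opexp_sums[of "t *\<^sub>R B"] by (simp only: f_eq)
  have deriv: "(f n has_derivative f' n t) (at t within X)" for n t X
  proof -
    have "((\<lambda>t. t ^ n / fact n) has_vector_derivative (real n * t ^ (n - 1) / fact n)) (at t within X)"
      unfolding has_real_derivative_iff_has_vector_derivative[symmetric]
      by (auto intro!: derivative_eq_intros)
    from bounded_linear.has_vector_derivative[OF bounded_linear_scaleR_left this, of "opow B n"]
    show ?thesis unfolding f_def[abs_def] f'_def[abs_def] has_vector_derivative_def .
  qed
  \<comment> \<open>The term of index 0 has derivative 0, so \<open>n + 1\<close> derivatives sum to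
    \<open>B\<close> composed with \<open>n\<close> terms;
    \<open>eventually_sequentially_Suc\<close> absorbs the shift below.\<close>
  have partial: "(\<Sum>i<Suc n. f' i t h) = h *\<^sub>R (B o\<^sub>L (\<Sum>i<n. f i t))" for n t h
  proof -
    have "f' (Suc i) t h = h *\<^sub>R (B o\<^sub>L f i t)" for i
    proof -
      have "real (Suc i) * t ^ i / fact (Suc i) = t ^ i / fact i"
        unfolding fact_Suc by (rule nonzero_mult_divide_mult_cancel_left) simp
      then show ?thesis
        by (simp only: f'_def f_def opow_Suc comp.scaleR_right diff_Suc_1)
    qed
    moreover have "f' 0 t h = 0" by (simp add: f'_def)
    ultimately show ?thesis
      by (simp only: sum.lessThan_Suc_shift comp.sum_right scaleR_sum_right add_0)
  qed
  have unif: "uniform_limit {- R..R} (\<lambda>n t. \<Sum>i<n. f i t) (\<lambda>t. opexp (t *\<^sub>R B)) sequentially"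
  proof -
    have "uniform_limit {- R..R} (\<lambda>n t. \<Sum>i<n. f i t) (\<lambda>t. suminf (\<lambda>i. f i t)) sequentially"
    proof (rule Weierstrass_m_test)
      show "summable (\<lambda>n. (R * norm B) ^ n /\<^sub>R fact n)" by (rule summable_exp_generic)
      fix n t assume "t \<in> {- R..R}"
      then have "norm (t *\<^sub>R B) ^ n \<le> (R * norm B) ^ n"
        by (intro power_mono) (auto intro!: mult_right_mono)
      then show "norm (f n t) \<le> (R * norm B) ^ n /\<^sub>R fact n"
        using norm_opexp_term_le[of n "t *\<^sub>R B"] unfolding f_eq
        by (auto simp: divide_inverse intro: order_trans mult_left_mono)
    qed
    then show ?thesis using sums by (simp add: sums_iff)
  qed
  have "\<exists>g. \<forall>t\<in>{- R..R}. (\<lambda>n. f n t) sums g t \<and> (g has_derivative (\<lambda>h. h *\<^sub>R (B o\<^sub>L opexp (t *\<^sub>R B)))) (at t within {- R..R})"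
  proof (rule has_derivative_series[of "{- R..R}" f f' "\<lambda>t h. h *\<^sub>R (B o\<^sub>L opexp (t *\<^sub>R B))" t])
    show "(f n has_derivative f' n t) (at t within {- R..R})" for n t by (rule deriv)
    show "t \<in> {- R..R}" using tR by simp
    show "(\<lambda>n. f n t) sums opexp (t *\<^sub>R B)" by (rule sums)
    fix e :: real assume "e > 0"
    have B1: "norm B + 1 > 0" using norm_ge_zero[of B] by linarith
    with \<open>e > 0\<close> have "e / (norm B + 1) > 0" by simp
    from uniform_limitD[OF unif this]
    have "\<forall>\<^sub>F n in sequentially. \<forall>t\<in>{- R..R}. dist (\<Sum>i<n. f i t) (opexp (t *\<^sub>R B)) < e / (norm B + 1)" .
    then have "\<forall>\<^sub>F n in sequentially. \<forall>t\<in>{- R..R}. \<forall>h. norm ((\<Sum>i<Suc n. f' i t h) - h *\<^sub>R (B o\<^sub>L opexp (t *\<^sub>R B))) \<le> e * norm h"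
    proof eventually_elim
      case (elim n)
      show ?case
      proof (intro ballI allI)
        fix t h assume t: "t \<in> {- R..R}"
        have "norm (B o\<^sub>L ((\<Sum>i<n. f i t) - opexp (t *\<^sub>R B))) \<le> norm B * norm ((\<Sum>i<n. f i t) - opexp (t *\<^sub>R B))"
          by (rule norm_blinfun_compose)
        also have "\<dots> \<le> norm B * (e / (norm B + 1))"
          using elim t by (intro mult_left_mono) (auto simp: dist_norm less_imp_le)
        also have "\<dots> \<le> (norm B + 1) * (e / (norm B + 1))"
          using \<open>e > 0\<close> B1 by (intro mult_right_mono) auto
        also have "\<dots> = e" using B1 by simp
        finally have le: "norm (B o\<^sub>L ((\<Sum>i<n. f i t) - opexp (t *\<^sub>R B))) \<le> e" .
        have "(\<Sum>i<Suc n. f' i t h) - h *\<^sub>R (B o\<^sub>L opexp (t *\<^sub>R B)) = h *\<^sub>R (B o\<^sub>L ((\<Sum>i<n. f i t) - opexp (t *\<^sub>R B)))"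
          by (simp only: partial comp.diff_right scaleR_diff_right)
        then show "norm ((\<Sum>i<Suc n. f' i t h) - h *\<^sub>R (B o\<^sub>L opexp (t *\<^sub>R B))) \<le> e * norm h"
          using mult_left_mono[OF le norm_ge_zero[of h]] by (simp only: norm_scaleR real_norm_def mult.commute)
      qed
    qed
    then show "\<forall>\<^sub>F n in sequentially. \<forall>t\<in>{- R..R}. \<forall>h. norm ((\<Sum>i<n. f' i t h) - h *\<^sub>R (B o\<^sub>L opexp (t *\<^sub>R B))) \<le> e * norm h"
      by (rule eventually_sequentially_Suc[THEN iffD1])
  qed simp
  then obtain g where g: "\<And>t. t \<in> {- R..R} \<Longrightarrow> (\<lambda>n. f n t) sums g t"
    "\<And>t. t \<in> {- R..R} \<Longrightarrow> (g has_derivative (\<lambda>h. h *\<^sub>R (B o\<^sub>L opexp (t *\<^sub>R B)))) (at t within {- R..R})"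
    by blast
  have eq: "g u = opexp (u *\<^sub>R B)" if "- R < u" "u < R" for u
    using that by (intro sums_unique2[OF g(1) sums]) auto
  have "(g has_vector_derivative B o\<^sub>L opexp (t *\<^sub>R B)) (at t within {- R..R})"
    using g(2)[of t] tR by (simp add: has_vector_derivative_def)
  then have "(g has_vector_derivative B o\<^sub>L opexp (t *\<^sub>R B)) (at t)"
    using tR by (simp add: at_within_Icc_at)
  then have "((\<lambda>t. opexp (t *\<^sub>R B)) has_vector_derivative B o\<^sub>L opexp (t *\<^sub>R B)) (at t)"
    by (rule has_vector_derivative_transform_within_open[of _ _ _ "{- R<..<R}"])
       (use tR in \<open>auto simp: eq\<close>)
  then show ?thesis by (rule has_vector_derivative_at_within)
qed

text \<open>\<open>opexp (t *\<^sub>R (- B)) (\<phi> t)\<close> has derivative 0. In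
  \<open>opexp_add\<close> and \<open>opexp_scaleR_id\<close> this uniqueness takes the place of
  multiplying series.\<close>

lemma opexp_ode_unique:
  fixes B :: "'a::banach \<Rightarrow>\<^sub>L 'a"
  assumes \<phi>: "\<And>t. (\<phi> has_vector_derivative B (\<phi> t)) (at t)"
  shows "\<phi> t = opexp (t *\<^sub>R B) (\<phi> 0)"
proof -
  have comm: "opexp (t *\<^sub>R C) (C x) = C (opexp (t *\<^sub>R C) x)" for C :: "'a \<Rightarrow>\<^sub>L 'a" and t x
  proof -
    have "C o\<^sub>L (t *\<^sub>R C) = (t *\<^sub>R C) o\<^sub>L C"
      by (intro blinfun_eqI) (simp add: blinfun.bilinear_simps)
    from arg_cong[OF opexp_commute[OF this], of "\<lambda>D. D x"] show ?thesis by simp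
  qed
  have inv: "opexp (t *\<^sub>R (- C)) (\<psi> t) = \<psi> 0"
    if \<psi>: "\<And>t. (\<psi> has_vector_derivative C (\<psi> t)) (at t)" for \<psi> and C :: "'a \<Rightarrow>\<^sub>L 'a" and t
  proof -
    have "((\<lambda>t. opexp (t *\<^sub>R (- C)) (\<psi> t)) has_vector_derivative 0) (at t within UNIV)" for t
    proof -
      have "((\<lambda>t. opexp (t *\<^sub>R (- C)) (\<psi> t)) has_vector_derivative
          opexp (t *\<^sub>R (- C)) (C (\<psi> t)) + ((- C) o\<^sub>L opexp (t *\<^sub>R (- C))) (\<psi> t)) (at t)"
        by (rule blinfun.has_vector_derivative[OF opexp_has_vector_derivative \<psi>])
      moreover have "opexp (t *\<^sub>R (- C)) (C (\<psi> t)) + ((- C) o\<^sub>L opexp (t *\<^sub>R (- C))) (\<psi> t) = 0"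
        using comm[of t "- C" "\<psi> t"] by (simp add: blinfun.bilinear_simps)
      ultimately show ?thesis by (simp only:)
    qed
    then obtain c where "\<And>t. opexp (t *\<^sub>R (- C)) (\<psi> t) = c"
      using has_vector_derivative_zero_constant[of UNIV "\<lambda>t. opexp (t *\<^sub>R (- C)) (\<psi> t)"] by auto
    from this[of t] this[of 0] show ?thesis by simp
  qed
  have "((\<lambda>t. opexp (t *\<^sub>R (- B)) x) has_vector_derivative (- B) (opexp (t *\<^sub>R (- B)) x)) (at t)" for x t
    using blinfun.has_vector_derivative[OF opexp_has_vector_derivative[of "- B" t UNIV] has_vector_derivative_const[of x]]
    by simp
  \<comment> \<open>The auxiliary fact is applied to the exponential itself: the exponentials at
    \<open>t\<close> and \<open>- t\<close> are inverse to each other.\<close>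
  from inv[of "\<lambda>t. opexp (t *\<^sub>R (- B)) x" "- B" t for x, OF this]
  have "opexp (t *\<^sub>R B) (opexp (t *\<^sub>R (- B)) (\<phi> t)) = \<phi> t" by simp
  then show ?thesis using inv[of \<phi> B t, OF \<phi>] by simp
qed

lemma opexp_add:
  fixes B C :: "'a::banach \<Rightarrow>\<^sub>L 'a"
  assumes comm: "B o\<^sub>L C = C o\<^sub>L B"
  shows "opexp (B + C) = opexp B o\<^sub>L opexp C"
proof (rule blinfun_eqI)
  fix x
  define \<phi> where "\<phi> t = opexp (t *\<^sub>R B) (opexp (t *\<^sub>R C) x)" for t
  have "(\<phi> has_vector_derivative (B + C) (\<phi> t)) (at t)" for t
  proof -
    have "((\<lambda>t. opexp (t *\<^sub>R C) x) has_vector_derivative C (opexp (t *\<^sub>R C) x)) (at t)"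
      using blinfun.has_vector_derivative[OF opexp_has_vector_derivative[of C t UNIV] has_vector_derivative_const[of x]]
      by simp
    from blinfun.has_vector_derivative[OF opexp_has_vector_derivative[of B t UNIV] this]
    have "(\<phi> has_vector_derivative opexp (t *\<^sub>R B) (C (opexp (t *\<^sub>R C) x)) + B (\<phi> t)) (at t)"
      by (simp add: \<phi>_def[abs_def])
    moreover have "opexp (t *\<^sub>R B) (C y) = C (opexp (t *\<^sub>R B) y)" for y
    proof -
      have "C o\<^sub>L (t *\<^sub>R B) = (t *\<^sub>R B) o\<^sub>L C"
        using comm by (metis bounded_bilinear.scaleR_left bounded_bilinear.scaleR_right bounded_bilinear_blinfun_compose)
      from arg_cong[OF opexp_commute[OF this], of "\<lambda>D. D y"] show ?thesis by simp
    qed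
    ultimately show ?thesis by (simp add: \<phi>_def blinfun.bilinear_simps add.commute)
  qed
  from opexp_ode_unique[of \<phi> "B + C" 1, OF this] show "opexp (B + C) x = (opexp B o\<^sub>L opexp C) x"
    by (simp add: \<phi>_def)
qed

lemma opexp_scaleR_id: "opexp (r *\<^sub>R id_blinfun) = exp r *\<^sub>R (id_blinfun :: 'a::banach \<Rightarrow>\<^sub>L 'a)"
proof (rule blinfun_eqI)
  fix x :: 'a
  have "((\<lambda>t. exp (r * t) *\<^sub>R x) has_vector_derivative (r *\<^sub>R id_blinfun) (exp (r * t) *\<^sub>R x)) (at t)" for t
  proof -
    have "((\<lambda>t. exp (r * t)) has_vector_derivative (r * exp (r * t))) (at t)"
      unfolding has_real_derivative_iff_has_vector_derivative[symmetric]
      by (auto intro!: derivative_eq_intros)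
    from bounded_linear.has_vector_derivative[OF bounded_linear_scaleR_left this, of x]
    show ?thesis by (simp add: blinfun.bilinear_simps mult.commute)
  qed
  from opexp_ode_unique[of "\<lambda>t. exp (r * t) *\<^sub>R x" "r *\<^sub>R id_blinfun" 1, OF this]
  show "opexp (r *\<^sub>R id_blinfun) x = (exp r *\<^sub>R id_blinfun) x" by (simp add: blinfun.bilinear_simps)
qed

text \<open>A scalar split off in this way keeps its sign, which the bound by the exponential of the
  norm would lose. This gives the decay off the real axis and the sharp estimate for
  \<open>opexp ((- \<alpha>) *\<^sub>R A)\<close>.\<close>

lemma norm_opexp_shift_le:
  fixes B :: "'a::banach \<Rightarrow>\<^sub>L 'a"
  shows "norm (opexp (r *\<^sub>R id_blinfun + B)) \<le> exp r * norm (opexp B)"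
proof -
  have "opexp (r *\<^sub>R id_blinfun + B) = (exp r *\<^sub>R id_blinfun) o\<^sub>L opexp B"
    by (subst opexp_add) (auto intro!: blinfun_eqI simp: opexp_scaleR_id blinfun.bilinear_simps)
  also have "\<dots> = exp r *\<^sub>R opexp B"
    by (auto intro!: blinfun_eqI simp: blinfun.bilinear_simps)
  finally show ?thesis by simp
qed

section \<open>The spectrum of the generator\<close>

text \<open>The inverse is only real-linear here; \<open>cspectrum_iff\<close> supplies its complex
  linearity.\<close>

definition invertible_op :: "('a::real_normed_vector \<Rightarrow>\<^sub>L 'a) \<Rightarrow> bool" where
  "invertible_op B \<longleftrightarrow> (\<exists>R. R o\<^sub>L B = id_blinfun \<and> B o\<^sub>L R = id_blinfun)"

lemma comp_apply_eq: "B o\<^sub>L C = D \<Longrightarrow> B (C x) = D x"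
  by (metis blinfun_apply_blinfun_compose)

lemma blinfun_compose_assoc: "(B o\<^sub>L C) o\<^sub>L D = B o\<^sub>L (C o\<^sub>L D)"
  by (rule blinfun_eqI) simp

lemma invertible_op_neumann:
  fixes E :: "'a::banach \<Rightarrow>\<^sub>L 'a"
  assumes "norm E < 1"
  shows "invertible_op (id_blinfun - E)"
proof -
  interpret comp: bounded_bilinear "blinfun_compose :: ('a \<Rightarrow>\<^sub>L 'a) \<Rightarrow> _ \<Rightarrow> _"
    by (rule bounded_bilinear_blinfun_compose)
  have "summable (opow E)"
  proof (rule summable_comparison_test'[where g = "\<lambda>n. norm E ^ n" and N = 0])
    show "summable (\<lambda>n. norm E ^ n)" using assms by (intro summable_geometric) simp
  qed (rule norm_opow_le)
  then obtain S where S: "opow E sums S" by (auto simp: summable_def)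
  have "(\<lambda>n. opow E (Suc n)) sums (E o\<^sub>L S)"
    using bounded_linear.sums[OF comp.bounded_linear_right S, of E] by (simp only: opow_Suc)
  then have "opow E sums ((E o\<^sub>L S) + opow E 0)" by (simp only: sums_Suc_iff)
  from arg_cong[OF sums_unique2[OF S this], of "\<lambda>X. X - (E o\<^sub>L S)"]
  have 1: "S - (E o\<^sub>L S) = id_blinfun" by (simp only: add_diff_cancel_left' opow_0)
  have "opow E n o\<^sub>L E = opow E (Suc n)" for n
    using opow_commute[of E E n] by (simp only: opow_Suc)
  then have "(\<lambda>n. opow E (Suc n)) sums (S o\<^sub>L E)"
    using bounded_linear.sums[OF comp.bounded_linear_left S, of E] by (simp only:)
  then have "opow E sums ((S o\<^sub>L E) + opow E 0)" by (simp only: sums_Suc_iff)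
  from arg_cong[OF sums_unique2[OF S this], of "\<lambda>X. X - (S o\<^sub>L E)"]
  have 2: "S - (S o\<^sub>L E) = id_blinfun" by (simp only: add_diff_cancel_left' opow_0)
  have "S o\<^sub>L (id_blinfun - E) = S - (S o\<^sub>L E)" "(id_blinfun - E) o\<^sub>L S = S - (E o\<^sub>L S)"
    by (auto intro!: blinfun_eqI simp: blinfun.bilinear_simps)
  then show ?thesis unfolding invertible_op_def 1 2 by blast
qed

text \<open>\<open>R o\<^sub>L K\<close> is a left and \<open>K o\<^sub>L R\<close> a right inverse
  of \<open>C\<close>, so the two coincide.\<close>

lemma invertible_op_factor:
  assumes "C o\<^sub>L K = D" "K o\<^sub>L C = D" "invertible_op D"
  shows "invertible_op C"
proof -
  obtain R where R: "R o\<^sub>L D = id_blinfun" "D o\<^sub>L R = id_blinfun"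
    using assms(3) by (auto simp: invertible_op_def)
  have l: "(R o\<^sub>L K) o\<^sub>L C = id_blinfun"
    using R(1) assms(2) by (simp add: blinfun_compose_assoc)
  have r: "C o\<^sub>L (K o\<^sub>L R) = id_blinfun"
    using R(2) assms(1) by (simp add: blinfun_compose_assoc[symmetric])
  have "R o\<^sub>L K = (R o\<^sub>L K) o\<^sub>L (C o\<^sub>L (K o\<^sub>L R))" unfolding r by (simp add: blinfun_eqI)
  also have "\<dots> = K o\<^sub>L R" unfolding blinfun_compose_assoc[symmetric] l by (simp add: blinfun_eqI)
  finally show ?thesis unfolding invertible_op_def using l r by metis
qed

lemma invertible_op_uminus: "invertible_op (- B) \<Longrightarrow> invertible_op B"
proof -
  assume "invertible_op (- B)"
  then obtain R where R: "R o\<^sub>L (- B) = id_blinfun" "(- B) o\<^sub>L R = id_blinfun" by (auto simp: invertible_op_def)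
  have "(- R) o\<^sub>L B = R o\<^sub>L (- B)" "B o\<^sub>L (- R) = (- B) o\<^sub>L R"
    by (auto intro!: blinfun_eqI simp: blinfun.bilinear_simps)
  then show ?thesis unfolding invertible_op_def using R by metis
qed

text \<open>The inverse of an operator that commutes with \<open>J\<close> commutes with
  \<open>J\<close> as well.\<close>

lemma cspectrum_iff:
  assumes "clin J A" and cs: "complex_structure J"
  shows "\<mu> \<notin> cspectrum J A \<longleftrightarrow> invertible_op (A - cscale J \<mu> id_blinfun)"
proof -
  let ?C = "A - cscale J \<mu> id_blinfun"
  have AJ: "A (J x) = J (A x)" for x using comp_apply_eq[OF assms(1)[unfolded clin_def]] by simp
  have CJ: "?C (J x) = J (?C x)" for x
    by (simp add: AJ cscale_def blinfun.bilinear_simps)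
  have "clin J R" if "R o\<^sub>L ?C = id_blinfun" "?C o\<^sub>L R = id_blinfun" for R
  proof -
    have RC: "R (?C x) = x" "?C (R x) = x" for x
      using comp_apply_eq[OF that(1)] comp_apply_eq[OF that(2)] by simp_all
    have "R (J x) = J (R x)" for x
      using RC(1)[of "J (R x)"] CJ[of "R x"] RC(2)[of x] by simp
    then show ?thesis unfolding clin_def by (intro blinfun_eqI) simp
  qed
  then show ?thesis unfolding cspectrum_def invertible_op_def by blast
qed

lemma continuous_on_opexp:
  fixes B :: "'a::banach \<Rightarrow>\<^sub>L 'a"
  shows "continuous_on S (\<lambda>t. opexp (t *\<^sub>R B))"
  unfolding continuous_on_eq_continuous_within
  by (intro ballI has_vector_derivative_continuous[OF opexp_has_vector_derivative])

text \<open>The derivative of \<open>(1 + c * t) *\<^sub>R opexp (t *\<^sub>R B)\<close> is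
  integrated. The choice \<open>c = 0\<close> factors \<open>opexp B - id_blinfun\<close> through
  \<open>B\<close>; with \<open>c = - 1 / N\<close> the weight is 0 at \<open>N\<close> and the
  boundary term \<open>opexp (N *\<^sub>R B)\<close> drops out.\<close>

lemma weighted_opexp_integral:
  fixes B :: "'a::banach \<Rightarrow>\<^sub>L 'a" and c N :: real
  assumes "N \<ge> 0"
  defines "K \<equiv> integral {0..N} (\<lambda>t. (1 + c * t) *\<^sub>R opexp (t *\<^sub>R B))"
  shows "B o\<^sub>L K = (1 + c * N) *\<^sub>R opexp (N *\<^sub>R B) - id_blinfun - c *\<^sub>R integral {0..N} (\<lambda>t. opexp (t *\<^sub>R B))"
    and "K o\<^sub>L B = (1 + c * N) *\<^sub>R opexp (N *\<^sub>R B) - id_blinfun - c *\<^sub>R integral {0..N} (\<lambda>t. opexp (t *\<^sub>R B))"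
proof -
  interpret comp: bounded_bilinear "blinfun_compose :: ('a \<Rightarrow>\<^sub>L 'a) \<Rightarrow> _ \<Rightarrow> _"
    by (rule bounded_bilinear_blinfun_compose)
  note cont = continuous_on_opexp[of _ B]
  have deriv: "((\<lambda>t. (1 + c * t) *\<^sub>R opexp (t *\<^sub>R B)) has_vector_derivative
      (1 + c * t) *\<^sub>R (B o\<^sub>L opexp (t *\<^sub>R B)) + c *\<^sub>R opexp (t *\<^sub>R B)) (at t within S)" for t S
  proof -
    have "((\<lambda>t. 1 + c * t) has_vector_derivative c) (at t within S)"
      by (auto intro!: derivative_eq_intros)
    from bounded_bilinear.has_vector_derivative[OF bounded_bilinear_scaleR this opexp_has_vector_derivative]
    show ?thesis .
  qed
  have intK: "(\<lambda>t. (1 + c * t) *\<^sub>R opexp (t *\<^sub>R B)) integrable_on {0..N}"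
    by (intro integrable_continuous_real continuous_intros cont)
  have intB: "(\<lambda>t. (1 + c * t) *\<^sub>R (B o\<^sub>L opexp (t *\<^sub>R B))) integrable_on {0..N}"
    by (intro integrable_continuous_real continuous_intros comp.continuous_on cont)
  have intE: "(\<lambda>t. c *\<^sub>R opexp (t *\<^sub>R B)) integrable_on {0..N}"
    by (intro integrable_continuous_real continuous_intros cont)
  have "integral {0..N} (\<lambda>t. (1 + c * t) *\<^sub>R (B o\<^sub>L opexp (t *\<^sub>R B))) + integral {0..N} (\<lambda>t. c *\<^sub>R opexp (t *\<^sub>R B))
      = (1 + c * N) *\<^sub>R opexp (N *\<^sub>R B) - (1 + c * 0) *\<^sub>R opexp (0 *\<^sub>R B)"
    unfolding integral_add[OF intB intE, symmetric]
    by (rule integral_unique[OF fundamental_theorem_of_calculus[OF \<open>N \<ge> 0\<close> deriv]])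
  then have main: "integral {0..N} (\<lambda>t. (1 + c * t) *\<^sub>R (B o\<^sub>L opexp (t *\<^sub>R B))) =
      (1 + c * N) *\<^sub>R opexp (N *\<^sub>R B) - id_blinfun - c *\<^sub>R integral {0..N} (\<lambda>t. opexp (t *\<^sub>R B))"
    by (simp add: algebra_simps)
  show "B o\<^sub>L K = (1 + c * N) *\<^sub>R opexp (N *\<^sub>R B) - id_blinfun - c *\<^sub>R integral {0..N} (\<lambda>t. opexp (t *\<^sub>R B))"
    unfolding main[symmetric] K_def
    using integral_linear[OF intK comp.bounded_linear_right[of B]] by (simp add: o_def comp.scaleR_right)
  have "opexp (t *\<^sub>R B) o\<^sub>L B = B o\<^sub>L opexp (t *\<^sub>R B)" for t
    by (rule opexp_commute[symmetric]) (simp add: comp.scaleR_left comp.scaleR_right)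
  then show "K o\<^sub>L B = (1 + c * N) *\<^sub>R opexp (N *\<^sub>R B) - id_blinfun - c *\<^sub>R integral {0..N} (\<lambda>t. opexp (t *\<^sub>R B))"
    unfolding main[symmetric] K_def
    using integral_linear[OF intK comp.bounded_linear_left[of B]] by (simp add: o_def comp.scaleR_left)
qed

lemma invertible_op_of_norm_opexp:
  fixes B :: "'a::banach \<Rightarrow>\<^sub>L 'a"
  assumes "norm (opexp B) < 1"
  shows "invertible_op B"
proof (rule invertible_op_uminus, rule invertible_op_factor)
  let ?K = "integral {0..1} (\<lambda>t. (1 + 0 * t) *\<^sub>R opexp (t *\<^sub>R B))"
  have "(- B) o\<^sub>L ?K = - (B o\<^sub>L ?K)" "?K o\<^sub>L (- B) = - (?K o\<^sub>L B)"
    by (auto intro!: blinfun_eqI simp: blinfun.bilinear_simps)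
  then show "(- B) o\<^sub>L ?K = id_blinfun - opexp B" "?K o\<^sub>L (- B) = id_blinfun - opexp B"
    using weighted_opexp_integral[where N = 1 and c = 0 and B = B] by simp_all
qed (rule invertible_op_neumann[OF assms])

section \<open>Spectrum and exponential of a bounded generator\<close>

context isometry_group
begin

lemma eq_opexp:
  fixes B :: "'a \<Rightarrow>\<^sub>L 'a"
  assumes gen: "\<And>x. generates T x (B x)"
  shows "T t = opexp (t *\<^sub>R B)"
proof (rule blinfun_eqI)
  fix x
  \<comment> \<open>Both vectors are the image of \<open>T t x\<close> under the generator.\<close>
  have "T t (B x) = B (T t x)" for t
  proof (rule generates_unique)
    show "generates T (T t x) (T t (B x))"
      by (rule generates_bounded_linear[OF gen blinfun.bounded_linear_right]) (simp add: T_add[symmetric] add.commute)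
  qed (rule gen)
  then have "((\<lambda>t. T t x) has_vector_derivative B (T t x)) (at t)" for t
    using generates_deriv[OF gen, of x t UNIV] by simp
  from opexp_ode_unique[of "\<lambda>t. T t x" B t, OF this] show "T t x = opexp (t *\<^sub>R B) x" by simp
qed

lemma norm_compose_T: "norm (T t o\<^sub>L B) = norm B"
proof (rule antisym)
  show "norm (T t o\<^sub>L B) \<le> norm B"
    by (rule norm_blinfun_bound) (auto simp: norm_blinfun)
  show "norm B \<le> norm (T t o\<^sub>L B)"
  proof (rule norm_blinfun_bound)
    fix x show "norm (B x) \<le> norm (T t o\<^sub>L B) * norm x"
      using norm_blinfun[of "T t o\<^sub>L B" x] by simp
  qed simp
qed

lemma norm_T_le_1: "norm (T t) \<le> 1"
  by (rule norm_blinfun_bound) auto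

text \<open>The average of \<open>opexp (t *\<^sub>R B)\<close> over \<open>{0..N}\<close> differs
  from the identity by a multiple of \<open>B\<close>. Coercivity bounds its norm by
  \<open>2 / (\<kappa> * N)\<close>, so for large \<open>N\<close> the Neumann series applies. In
  this way a mere lower bound yields surjectivity.\<close>

lemma invertible_op_coercive:
  fixes B :: "'a \<Rightarrow>\<^sub>L 'a"
  assumes gen: "\<And>x. generates T x (B x)" and co: "coercive T \<kappa>"
  shows "invertible_op B"
proof (rule invertible_op_uminus, rule invertible_op_factor)
  \<comment> \<open>With 3 the average has norm at most 2/3; any \<open>N\<close> above
    \<open>2 / \<kappa>\<close> makes it less than 1.\<close>
  define N where "N = 3 / \<kappa>"
  have N: "N > 0" using co by (simp add: N_def coercive_def)
  let ?K = "integral {0..N} (\<lambda>t. (1 + (- 1 / N) * t) *\<^sub>R opexp (t *\<^sub>R B))"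
  let ?S = "integral {0..N} (\<lambda>t. opexp (t *\<^sub>R B))"
  have "(- B) o\<^sub>L ?K = - (B o\<^sub>L ?K)" "?K o\<^sub>L (- B) = - (?K o\<^sub>L B)"
    by (auto intro!: blinfun_eqI simp: blinfun.bilinear_simps)
  then show "(- B) o\<^sub>L ?K = id_blinfun - (1 / N) *\<^sub>R ?S" "?K o\<^sub>L (- B) = id_blinfun - (1 / N) *\<^sub>R ?S"
    using weighted_opexp_integral[where N = N and c = "- 1 / N" and B = B] N by simp_all
  have "norm ?S \<le> 2 / \<kappa>"
  proof (rule norm_blinfun_bound)
    fix x
    have "continuous_on {0..N} (\<lambda>t. opexp (t *\<^sub>R B))"
      by (rule continuous_on_opexp)
    then have "?S x = integral {0..N} (\<lambda>t. T t x)"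
      by (simp add: blinfun_apply_integral integrable_continuous_real eq_opexp[OF gen])
    then show "norm (?S x) \<le> 2 / \<kappa> * norm x"
      using norm_orbit_integral_le[OF gen[of x] co, of 0 N] N by simp
  qed (use co in \<open>simp add: coercive_def\<close>)
  have "norm ((1 / N) *\<^sub>R ?S) = (1 / N) * norm ?S" using N by simp
  also have "\<dots> \<le> (1 / N) * (2 / \<kappa>)" using N \<open>norm ?S \<le> 2 / \<kappa>\<close> by (intro mult_left_mono) auto
  also have "\<dots> < 1" using co by (simp add: N_def coercive_def)
  finally show "invertible_op (id_blinfun - (1 / N) *\<^sub>R ?S)" by (rule invertible_op_neumann)
qed


lemma cspectrum_eq_beurling_spectrum:
  assumes cA: "clin J A" and gen: "\<And>x. generates T x (J (A x))"
  shows "cspectrum J A = complex_of_real ` beurling_spectrum J T UNIV"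
proof -
  \<comment> \<open>\<open>B \<mu>\<close> is \<i>(\<mu> - A); for real \<open>\<mu>\<close> it
    generates the twisted group.\<close>
  define B where "B \<mu> = J o\<^sub>L (cscale J \<mu> id_blinfun - A)" for \<mu>
  have B_apply: "B \<mu> x = J (cmult J \<mu> x - A x)" for \<mu> x
    by (simp add: B_def blinfun.bilinear_simps cscale_apply)
  have resolvent: "\<mu> \<notin> cspectrum J A" if "invertible_op (B \<mu>)" for \<mu>
    unfolding cspectrum_iff[OF cA cs]
  proof -
    from that obtain R where R: "R o\<^sub>L B \<mu> = id_blinfun" "B \<mu> o\<^sub>L R = id_blinfun"
      by (auto simp: invertible_op_def)
    have RB: "R (B \<mu> x) = x" "B \<mu> (R x) = x" for x
      using comp_apply_eq[OF R(1)] comp_apply_eq[OF R(2)] by simp_all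
    have A\<mu>: "(A - cscale J \<mu> id_blinfun) x = J (B \<mu> x)" for x
      by (simp add: B_apply J_J[OF cs] blinfun.bilinear_simps cscale_apply)
    have "(R o\<^sub>L (- J)) o\<^sub>L (A - cscale J \<mu> id_blinfun) = id_blinfun"
      by (rule blinfun_eqI) (simp add: A\<mu> J_J[OF cs] RB blinfun.minus_left del: blinfun.diff_left)
    moreover have "(A - cscale J \<mu> id_blinfun) o\<^sub>L (R o\<^sub>L (- J)) = id_blinfun"
      by (rule blinfun_eqI) (simp add: A\<mu> J_J[OF cs] RB blinfun.bilinear_simps(5,6,7,8))
    ultimately show "invertible_op (A - cscale J \<mu> id_blinfun)" unfolding invertible_op_def by blast
  qed
  have gen_twist: "generates (twist J s T) x (B (of_real s) x)" for s x
    using generates_twist[OF gen[of x], of s] by (simp add: B_apply cmult_of_real blinfun.bilinear_simps)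
  have nonreal: "\<mu> \<notin> cspectrum J A" if "Im \<mu> \<noteq> 0" for \<mu>
  proof -
    \<comment> \<open>This sign makes the scalar part of \<open>\<sigma> *\<^sub>R B \<mu>\<close>
      negative, while the remaining part exponentiates to an isometry.\<close>
    define \<sigma> where "\<sigma> = sgn (Im \<mu>)"
    define s where "s = Re \<mu>"
    interpret U: isometry_group J "twist J s T" by (rule isometry_group_twist)
    have U: "twist J s T t = opexp (t *\<^sub>R B (of_real s))" for t
      by (rule U.eq_opexp[OF gen_twist])
    have split: "\<sigma> *\<^sub>R B \<mu> = (- \<bar>Im \<mu>\<bar>) *\<^sub>R id_blinfun + \<sigma> *\<^sub>R B (of_real s)"
    proof (rule blinfun_eqI)
      fix x
      have "\<sigma> * Im \<mu> = \<bar>Im \<mu>\<bar>" by (simp add: \<sigma>_def sgn_if)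
      then show "(\<sigma> *\<^sub>R B \<mu>) x = ((- \<bar>Im \<mu>\<bar>) *\<^sub>R id_blinfun + \<sigma> *\<^sub>R B (of_real s)) x"
        by (simp add: B_apply cmult_def s_def J_J[OF cs] blinfun.bilinear_simps algebra_simps)
    qed
    have "norm (opexp (\<sigma> *\<^sub>R B \<mu>)) \<le> exp (- \<bar>Im \<mu>\<bar>) * norm (twist J s T \<sigma>)"
      unfolding split U by (rule norm_opexp_shift_le)
    also have "\<dots> \<le> exp (- \<bar>Im \<mu>\<bar>) * 1" by (intro mult_left_mono U.norm_T_le_1) simp
    also have "\<dots> < 1" using that by simp
    finally have "invertible_op (\<sigma> *\<^sub>R B \<mu>)" by (rule invertible_op_of_norm_opexp)
    moreover have "\<sigma> = 1 \<or> \<sigma> = - 1" using that by (auto simp: \<sigma>_def sgn_if)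
    ultimately have "invertible_op (B \<mu>)" by (auto intro: invertible_op_uminus)
    then show ?thesis by (rule resolvent)
  qed
  show ?thesis
  proof (intro equalityI subsetI)
    fix \<mu> assume \<mu>: "\<mu> \<in> cspectrum J A"
    then have "Im \<mu> = 0" using nonreal by blast
    then have eq: "\<mu> = of_real (Re \<mu>)" by (simp add: complex_eq_iff)
    have "Re \<mu> \<in> beurling_spectrum J T UNIV"
    proof (rule ccontr)
      assume "Re \<mu> \<notin> beurling_spectrum J T UNIV"
      then obtain \<kappa> where co: "coercive (twist J (Re \<mu>) T) \<kappa>"
        by (rule coercive_off_beurling_spectrum)
      interpret U: isometry_group J "twist J (Re \<mu>) T" by (rule isometry_group_twist)
      have "invertible_op (B (of_real (Re \<mu>)))"
        by (rule U.invertible_op_coercive[OF gen_twist co])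
      then show False using resolvent \<mu> eq by metis
    qed
    then show "\<mu> \<in> complex_of_real ` beurling_spectrum J T UNIV" using eq by blast
  next
    fix \<mu> assume "\<mu> \<in> complex_of_real ` beurling_spectrum J T UNIV"
    then obtain \<gamma> where \<mu>: "\<mu> = of_real \<gamma>" and \<gamma>: "\<gamma> \<in> beurling_spectrum J T UNIV" by blast
    show "\<mu> \<in> cspectrum J A"
    proof (rule ccontr)
      assume "\<mu> \<notin> cspectrum J A"
      then obtain R where R: "R o\<^sub>L (A - cscale J \<mu> id_blinfun) = id_blinfun"
        unfolding cspectrum_iff[OF cA cs] invertible_op_def by blast
      \<comment> \<open>A left inverse bounds \<open>A - \<mu>\<close> from below; the added 1
        avoids division by 0.\<close>
      define \<kappa> where "\<kappa> = 1 / (norm R + 1)"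
      have R1: "norm R + 1 > 0" using norm_ge_zero[of R] by linarith
      have "coercive (twist J \<gamma> T) \<kappa>"
        unfolding coercive_def
      proof (intro conjI allI impI)
        show "0 < \<kappa>" using R1 by (simp add: \<kappa>_def)
        fix x v assume v: "generates (twist J \<gamma> T) x v"
        interpret U: isometry_group J "twist J \<gamma> T" by (rule isometry_group_twist)
        have "v = B \<mu> x" using U.generates_unique[OF v gen_twist] by (simp add: \<mu>)
        then have nv: "norm v = norm ((A - cscale J \<mu> id_blinfun) x)"
          by (simp add: B_apply norm_J[OF cs] blinfun.diff_left cscale_apply norm_minus_commute)
        have "norm x = norm (R ((A - cscale J \<mu> id_blinfun) x))"
          using comp_apply_eq[OF R, of x] by simp
        also have "\<dots> \<le> norm R * norm v" unfolding nv by (rule norm_blinfun)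
        also have "\<dots> \<le> (norm R + 1) * norm v" by (simp add: mult_right_mono)
        finally show "\<kappa> * norm x \<le> norm v" using R1 by (simp add: \<kappa>_def divide_le_eq mult.commute)
      qed
      then have co: "coercive (twist J s T) (\<kappa> / 2)" if "\<bar>s - \<gamma>\<bar> < \<kappa> / 2" for s
        using that by (intro coercive_twist_near) auto
      have h: "\<kappa> / 2 > 0" using R1 by (simp add: \<kappa>_def)
      have "l1act J T (fejer_kernel \<gamma> (\<kappa> / 2)) x = 0" for x
        by (rule l1act_fejer_eq_0[OF gen co h])
      then have "fourier (fejer_kernel \<gamma> (\<kappa> / 2)) \<gamma> = 0"
        using \<gamma> fejer_kernel_integrable[OF h] unfolding beurling_spectrum_def by blast
      \<comment> \<open>At \<open>\<gamma>\<close> the phase of the kernel cancels that of the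
        transform.\<close>
      moreover have "fourier (fejer_kernel \<gamma> (\<kappa> / 2)) \<gamma> = of_real fejer_mass"
      proof -
        have "fejer_kernel \<gamma> (\<kappa> / 2) t * exp (- \<i> * of_real (t * \<gamma>)) = of_real (fejer (\<kappa> / 2) t)" for t
        proof -
          have "exp (- \<i> * of_real (t * \<gamma>)) = cis (- (\<gamma> * t))" by (simp add: cis_conv_exp algebra_simps)
          then show ?thesis by (simp add: cis_mult scaleR_conv_of_real)
        qed
        then show ?thesis
          using has_integral_integral_lborel[OF integrable_fejer(1)[OF h]] integrable_fejer(2)[OF h]
          unfolding fourier_def by (simp add: integral_unique has_integral_of_real)
      qed
      ultimately show False using fejer_mass_pos by simp
    qed
  qed
qed

text \<open>The scalar split off is \<open>b\<close> for nonnegative \<open>\<alpha>\<close> and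
  \<open>a\<close> otherwise: the exponents \<open>- \<alpha> * b + \<alpha> * (b - a)\<close> and
  \<open>- \<alpha> * a - \<alpha> * (b - a)\<close> collapse to \<open>- \<alpha> * a\<close> and
  \<open>- \<alpha> * b\<close>.\<close>

lemma norm_opexp_generator_le:
  fixes A :: "'a \<Rightarrow>\<^sub>L 'a"
  assumes gen: "\<And>x. generates T x (J (A x))" and spec: "beurling_spectrum J T UNIV \<subseteq> {a<..<b}" and "a < b"
  shows "\<alpha> \<ge> 0 \<Longrightarrow> norm (opexp ((- \<alpha>) *\<^sub>R A)) \<le> exp (- \<alpha> * a)"
    and "\<alpha> \<le> 0 \<Longrightarrow> norm (opexp ((- \<alpha>) *\<^sub>R A)) \<le> exp (- \<alpha> * b)"
proof -
  have bound: "norm (opexp ((- \<alpha>) *\<^sub>R A)) \<le> exp (- \<alpha> * c) * exp (\<bar>\<alpha>\<bar> * (b - a))"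
    if "norm (c *\<^sub>R id_blinfun - A) \<le> b - a" for c
  proof -
    have eq: "(- \<alpha>) *\<^sub>R A = (- \<alpha> * c) *\<^sub>R id_blinfun + \<alpha> *\<^sub>R (c *\<^sub>R id_blinfun - A)"
      by (rule blinfun_eqI) (simp add: blinfun.bilinear_simps algebra_simps)
    have "norm (opexp (\<alpha> *\<^sub>R (c *\<^sub>R id_blinfun - A))) \<le> exp (norm (\<alpha> *\<^sub>R (c *\<^sub>R id_blinfun - A)))"
      by (rule norm_opexp_le)
    also have "\<dots> \<le> exp (\<bar>\<alpha>\<bar> * (b - a))" using that by (simp add: mult_left_mono)
    finally show ?thesis
      unfolding eq by (intro order_trans[OF norm_opexp_shift_le] mult_left_mono) auto
  qed
  have bA: "norm (b *\<^sub>R id_blinfun - A) \<le> b - a"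
  proof (rule norm_blinfun_bound)
    fix x
    have "b *\<^sub>R J x - J (A x) = J ((b *\<^sub>R id_blinfun - A) x)" by (simp add: blinfun.bilinear_simps)
    then show "norm ((b *\<^sub>R id_blinfun - A) x) \<le> (b - a) * norm x"
      using generator_bounds(1)[OF gen[of x] \<open>a < b\<close> spec] by (simp add: norm_J[OF cs])
  qed (use \<open>a < b\<close> in simp)
  have aA: "norm (a *\<^sub>R id_blinfun - A) \<le> b - a"
  proof (rule norm_blinfun_bound)
    fix x
    have "J (A x) - a *\<^sub>R J x = - J ((a *\<^sub>R id_blinfun - A) x)" by (simp add: blinfun.bilinear_simps)
    then show "norm ((a *\<^sub>R id_blinfun - A) x) \<le> (b - a) * norm x"
      using generator_bounds(2)[OF gen[of x] \<open>a < b\<close> spec] by (simp add: norm_J[OF cs])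
  qed (use \<open>a < b\<close> in simp)
  show "norm (opexp ((- \<alpha>) *\<^sub>R A)) \<le> exp (- \<alpha> * a)" if "\<alpha> \<ge> 0"
    using bound[OF bA] that by (simp add: algebra_simps flip: exp_add)
  show "norm (opexp ((- \<alpha>) *\<^sub>R A)) \<le> exp (- \<alpha> * b)" if "\<alpha> \<le> 0"
    using bound[OF aA] that by (simp add: algebra_simps flip: exp_add)
qed

end

text \<open>The supremum is attained, since the spectrum is compact and nonempty and the exponential
  continuous; it is the maximum of the informal statement.\<close>

theorem mainTheorem1:
  fixes J :: "'a::banach \<Rightarrow>\<^sub>L 'a" and T :: "real \<Rightarrow> ('a \<Rightarrow>\<^sub>L 'a)"
  assumes cs: "complex_structure J"
    and clinT: "\<forall>t. clin J (T t)"
    and T0: "T 0 = id_blinfun"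
    and Tadd: "\<forall>s t. T (s + t) = T s o\<^sub>L T t"
    and Tcont: "\<forall>x. continuous_on UNIV (\<lambda>t. T t x)"
    and Tisom: "\<forall>t x. norm (T t x) = norm x"
    and Tbij: "\<forall>t. bij (blinfun_apply (T t))"
    and Lcpt: "compact (beurling_spectrum J T UNIV)"
    and Lne: "beurling_spectrum J T UNIV \<noteq> {}"
  shows "\<exists>A. clin J A
      \<and> (\<forall>x. ((\<lambda>t. (1 / t) *\<^sub>R (T t x - x)) \<longlongrightarrow> J (A x)) (at 0))
      \<and> cspectrum J A = complex_of_real ` beurling_spectrum J T UNIV
      \<and> (\<exists>TT :: complex \<Rightarrow> ('a \<Rightarrow>\<^sub>L 'a).
            (\<forall>t. TT (complex_of_real t) = T t)
          \<and> (\<forall>z. \<exists>D. (TT has_derivative (\<lambda>h. cscale J h D)) (at z))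
          \<and> (\<forall>z. TT z = opexp (cscale J (\<i> * z) A))
          \<and> (\<forall>t \<alpha>. TT (Complex t \<alpha>) = T t o\<^sub>L opexp ((- \<alpha>) *\<^sub>R A)
                   \<and> TT (Complex t \<alpha>) = opexp ((- \<alpha>) *\<^sub>R A) o\<^sub>L T t)
          \<and> (\<forall>t \<alpha>. norm (TT (Complex t \<alpha>)) = norm (TT (Complex 0 \<alpha>))
                   \<and> norm (TT (Complex 0 \<alpha>))
                       \<le> (SUP mu\<in>beurling_spectrum J T UNIV. exp (- \<alpha> * mu))))"
proof -
  interpret isometry_group J T
  proof
    show "T t (J x) = J (T t x)" for t x
      using clinT comp_apply_eq[of "T t" J "J o\<^sub>L T t" x] by (simp add: clin_def)
  qed (use cs T0 Tadd Tcont Tisom in auto)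
  interpret comp: bounded_bilinear "blinfun_compose :: ('a \<Rightarrow>\<^sub>L 'a) \<Rightarrow> _ \<Rightarrow> _"
    by (rule bounded_bilinear_blinfun_compose)
  let ?\<Lambda> = "beurling_spectrum J T UNIV"
  obtain m M where m: "m \<in> ?\<Lambda>" "\<And>s. s \<in> ?\<Lambda> \<Longrightarrow> m \<le> s" and M: "M \<in> ?\<Lambda>" "\<And>s. s \<in> ?\<Lambda> \<Longrightarrow> s \<le> M"
    using compact_attains_inf[OF Lcpt Lne] compact_attains_sup[OF Lcpt Lne] by blast
  \<comment> \<open>The margin \<open>e\<close> puts the compact spectrum into an open interval.
    Boundedness of \<open>A\<close> uses \<open>e = 1\<close>; the norm estimate lets
    \<open>e\<close> tend to 0.\<close>
  have spec: "?\<Lambda> \<subseteq> {m - e<..<M + e}" "m - e < M + e" if "e > 0" for e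
    using m M that by force+
  have C: "norm w \<le> (\<bar>M + 1\<bar> + (M + 1 - (m - 1))) * norm x" if "generates T x w" for x w
  proof -
    have "norm w \<le> norm ((M + 1) *\<^sub>R J x) + norm ((M + 1) *\<^sub>R J x - w)"
      using norm_triangle_ineq4[of "(M + 1) *\<^sub>R J x" "(M + 1) *\<^sub>R J x - w"] by simp
    also have "\<dots> \<le> \<bar>M + 1\<bar> * norm x + (M + 1 - (m - 1)) * norm x"
      using generator_bounds(1)[OF that spec(2)[of 1] spec(1)[of 1]] by (simp add: norm_J[OF cs])
    finally show ?thesis by (simp add: algebra_simps)
  qed
  obtain A where cA: "clin J A" and gen: "\<And>x. generates T x (J (A x))"
    using bounded_generator[OF C] by blast
  have AJ: "A (J x) = J (A x)" for x
    using comp_apply_eq[OF cA[unfolded clin_def]] by simp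
  define B where "B = J o\<^sub>L A"
  define TT where "TT z = opexp (cscale J (\<i> * z) A)" for z
  have T_eq: "T t = opexp (t *\<^sub>R B)" for t
    by (rule eq_opexp) (simp add: B_def gen)
  have comm: "(t *\<^sub>R B) o\<^sub>L (r *\<^sub>R A) = (r *\<^sub>R A) o\<^sub>L (t *\<^sub>R B)" for t r
    by (rule blinfun_eqI) (simp add: B_def AJ blinfun.bilinear_simps mult.commute)
  \<comment> \<open>The exponent splits into commuting real multiples of \<open>B\<close> and
    \<open>A\<close>, so the exponential factors in either order.\<close>
  have arg_eq: "cscale J (\<i> * z) A = Re z *\<^sub>R B + (- Im z) *\<^sub>R A" for z
    by (simp add: cscale_def B_def)
  have TT1: "TT z = T (Re z) o\<^sub>L opexp ((- Im z) *\<^sub>R A)" for z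
    unfolding TT_def arg_eq T_eq by (rule opexp_add[OF comm])
  have TT2: "TT z = opexp ((- Im z) *\<^sub>R A) o\<^sub>L T (Re z)" for z
    unfolding TT_def arg_eq T_eq by (subst add.commute) (rule opexp_add[OF comm[symmetric]])
  \<comment> \<open>The real derivative of the product of the two factors turns out to be one
    operator multiplied by the complex number \<open>h\<close>, so \<open>TT\<close> is
    entire.\<close>
  have deriv: "(TT has_derivative (\<lambda>h. cscale J h (B o\<^sub>L TT z))) (at z)" for z
  proof -
    have e: "((\<lambda>t. opexp (t *\<^sub>R C)) has_derivative (\<lambda>h. h *\<^sub>R (C o\<^sub>L opexp (t *\<^sub>R C)))) (at t)" for C :: "'a \<Rightarrow>\<^sub>L 'a" and t
      using opexp_has_vector_derivative[of C t UNIV] by (simp add: has_vector_derivative_def)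
    have "((\<lambda>z. opexp (Re z *\<^sub>R B)) has_derivative (\<lambda>h. Re h *\<^sub>R (B o\<^sub>L opexp (Re z *\<^sub>R B)))) (at z)"
      by (rule has_derivative_compose[OF _ e, where f = Re and f' = Re])
         (rule bounded_linear_imp_has_derivative[OF bounded_linear_Re])
    moreover have "((\<lambda>z. opexp ((- Im z) *\<^sub>R A)) has_derivative (\<lambda>h. (- Im h) *\<^sub>R (A o\<^sub>L opexp ((- Im z) *\<^sub>R A)))) (at z)"
      by (rule has_derivative_compose[OF _ e, where f = "\<lambda>z. - Im z" and f' = "\<lambda>h. - Im h"])
         (intro bounded_linear_imp_has_derivative bounded_linear_minus bounded_linear_Im)
    ultimately have "((\<lambda>z. opexp (Re z *\<^sub>R B) o\<^sub>L opexp ((- Im z) *\<^sub>R A)) has_derivative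
       (\<lambda>h. (opexp (Re z *\<^sub>R B) o\<^sub>L ((- Im h) *\<^sub>R (A o\<^sub>L opexp ((- Im z) *\<^sub>R A)))) +
            ((Re h *\<^sub>R (B o\<^sub>L opexp (Re z *\<^sub>R B))) o\<^sub>L opexp ((- Im z) *\<^sub>R A)))) (at z)"
      by (rule comp.FDERIV)
    moreover have "(\<lambda>h. (opexp (Re z *\<^sub>R B) o\<^sub>L ((- Im h) *\<^sub>R (A o\<^sub>L opexp ((- Im z) *\<^sub>R A)))) +
            ((Re h *\<^sub>R (B o\<^sub>L opexp (Re z *\<^sub>R B))) o\<^sub>L opexp ((- Im z) *\<^sub>R A))) = (\<lambda>h. cscale J h (B o\<^sub>L TT z))"
    proof (intro ext blinfun_eqI)
      fix h x
      have "A o\<^sub>L (Re z *\<^sub>R B) = (Re z *\<^sub>R B) o\<^sub>L A" using comm[of "Re z" 1] by simp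
      from comp_apply_eq[OF opexp_commute[OF this]]
      have AE: "A (opexp (Re z *\<^sub>R B) y) = opexp (Re z *\<^sub>R B) (A y)" for y by simp
      show "((opexp (Re z *\<^sub>R B) o\<^sub>L ((- Im h) *\<^sub>R (A o\<^sub>L opexp ((- Im z) *\<^sub>R A)))) +
            ((Re h *\<^sub>R (B o\<^sub>L opexp (Re z *\<^sub>R B))) o\<^sub>L opexp ((- Im z) *\<^sub>R A))) x = cscale J h (B o\<^sub>L TT z) x"
        by (simp add: cscale_apply cmult_def TT1 T_eq[symmetric] AE[unfolded T_eq[symmetric]] B_def[THEN arg_cong[where f = blinfun_apply]]
            J_J[OF cs] blinfun.bilinear_simps)
    qed
    ultimately show ?thesis by (simp add: TT1[abs_def] T_eq)
  qed
  have bound: "norm (opexp ((- \<alpha>) *\<^sub>R A)) \<le> (SUP mu\<in>?\<Lambda>. exp (- \<alpha> * mu))" for \<alpha>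
  proof -
    have "compact ((\<lambda>mu. exp (- \<alpha> * mu)) ` ?\<Lambda>)"
      by (intro compact_continuous_image continuous_intros Lcpt)
    then have bdd: "bdd_above ((\<lambda>mu. exp (- \<alpha> * mu)) ` ?\<Lambda>)"
      by (intro bounded_imp_bdd_above compact_imp_bounded)
    have upper: "exp (- \<alpha> * s) \<le> (SUP mu\<in>?\<Lambda>. exp (- \<alpha> * mu))" if "s \<in> ?\<Lambda>" for s
      by (rule cSUP_upper[OF that bdd])
    \<comment> \<open>\<open>c\<close> is -1 at the lower and 1 at the upper end of the spectrum;
      \<open>s + c / (n + 1)\<close> is an endpoint of the enlarged interval.\<close>
    have lim: "norm (opexp ((- \<alpha>) *\<^sub>R A)) \<le> exp (- \<alpha> * s)"
      if "\<And>n. norm (opexp ((- \<alpha>) *\<^sub>R A)) \<le> exp (- \<alpha> * (s + c * inverse (real (Suc n))))" for s c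
    proof (rule LIMSEQ_le_const)
      have "(\<lambda>n. exp (- \<alpha> * (s + c * inverse (real (Suc n))))) \<longlonglongrightarrow> exp (- \<alpha> * (s + c * 0))"
        by (intro tendsto_intros LIMSEQ_inverse_real_of_nat)
      then show "(\<lambda>n. exp (- \<alpha> * (s + c * inverse (real (Suc n))))) \<longlonglongrightarrow> exp (- \<alpha> * s)" by simp
    qed (use that in blast)
    show ?thesis
    proof (cases "\<alpha> \<ge> 0")
      case True
      have "norm (opexp ((- \<alpha>) *\<^sub>R A)) \<le> exp (- \<alpha> * m)"
      proof (rule lim[of m "- 1"])
        show "norm (opexp ((- \<alpha>) *\<^sub>R A)) \<le> exp (- \<alpha> * (m + - 1 * inverse (real (Suc n))))" for n
          using norm_opexp_generator_le(1)[OF gen spec True, of "inverse (real (Suc n))"] by simp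
      qed
      then show ?thesis using upper[OF m(1)] by linarith
    next
      case False
      have "norm (opexp ((- \<alpha>) *\<^sub>R A)) \<le> exp (- \<alpha> * M)"
      proof (rule lim[of M 1])
        show "norm (opexp ((- \<alpha>) *\<^sub>R A)) \<le> exp (- \<alpha> * (M + 1 * inverse (real (Suc n))))" for n
          using norm_opexp_generator_le(2)[OF gen spec, of "inverse (real (Suc n))" \<alpha>] False by simp
      qed
      then show ?thesis using upper[OF M(1)] by linarith
    qed
  qed
  have TT_0: "TT (Complex 0 \<alpha>) = opexp ((- \<alpha>) *\<^sub>R A)" for \<alpha>
    unfolding TT1 by (rule blinfun_eqI) simp
  have lim: "((\<lambda>t. (1 / t) *\<^sub>R (T t x - x)) \<longlongrightarrow> J (A x)) (at 0)" for x
    using has_vector_derivative_quotient[OF gen[unfolded generates_def], of x]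
    by (simp add: inverse_eq_divide)
  have TT_real: "TT (complex_of_real t) = T t" for t
    unfolding TT1 by (rule blinfun_eqI) simp
  have TT_norm: "norm (TT (Complex t \<alpha>)) = norm (TT (Complex 0 \<alpha>))" for t \<alpha>
    by (simp add: TT1 norm_compose_T)
  have TT_bound: "norm (TT (Complex 0 \<alpha>)) \<le> (SUP mu\<in>?\<Lambda>. exp (- \<alpha> * mu))" for \<alpha>
    unfolding TT_0 by (rule bound)
  have TT_split: "TT (Complex t \<alpha>) = T t o\<^sub>L opexp ((- \<alpha>) *\<^sub>R A)" "TT (Complex t \<alpha>) = opexp ((- \<alpha>) *\<^sub>R A) o\<^sub>L T t" for t \<alpha>
    using TT1[of "Complex t \<alpha>"] TT2[of "Complex t \<alpha>"] by simp_all
  have ex_deriv: "\<exists>D. (TT has_derivative (\<lambda>h. cscale J h D)) (at z)" for z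
    using deriv by blast
  show ?thesis
    by (rule exI[of _ A])
       (intro conjI exI[of _ TT] allI cA lim cspectrum_eq_beurling_spectrum[OF cA gen] ex_deriv
          TT_real TT_norm TT_bound TT_split TT_def)
qed

end
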